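(* Let $(\mathbb X,\mathrm{dist}_{\mathbb X})$ be a compact Ahlfors $d$-regular length space and $K\colon\mathbb X\times\mathbb X\to\mathbb R$ a continuous, symmetric, positive definite kernel. Then there is a constant $c>0$, depending only on $\mathbb X$ and $K$, such that for every $\mu\in\mathcal P(\mathbb X)$ and every $L\ge1$, $$\min_{\nu\in\mathcal P^{\mathrm{Acurve}}_L(\mathbb X)}\mathscr D_K(\mu,\nu)\le\min_{\nu\in\mathcal P^{\mathrm{Lcurve}}_L(\mathbb X)}\mathscr D_K(\mu,\nu)\le c\,L^{-\frac{d}{3d-2}}.$$
   Context: $\mathbb X$ is a compact metric space with a finite nonnegative Borel measure $\sigma_{\mathbb X}$ of full support. Ahlfors $d$-regular: $\sigma_{\mathbb X}(B_r(x))\sim r^d$ for all $x\in\mathbb X$, $0<r\le\mathrm{diam}(\mathbb X)$, with constants independent of $x,r$ ($B_r(x)$ the closed ball). Length space: $\mathrm{dist}_{\mathbb X}(x,y)$ equals the infimum of lengths of continuous curves joining $x,y$. $\mathcal P(\mathbb X)$: Borel probability measures. Discrepancy: $\mathscr D_K(\mu,\nu)=\sup_{\|\varphi\|_{H_K(\mathbb X)}\le1}|\int\varphi\,d(\mu-\nu)|$ with $H_K(\mathbb X)$ the reproducing kernel Hilbert space of $K$; equivalently $\mathscr D_K^2(\mu,\nu)=\iint K\,d\mu\,d\mu-2\iint K\,d\mu\,d\nu+\iint K\,d\nu\,d\nu$. $\mathrm{Lip}(\mathbb X)$ is the set of Lipschitz continuous $\gamma\colon[0,1]\to\mathbb X$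 with $\gamma(0)=\gamma(1)$, and $L(\gamma)$ is the smallest Lipschitz constant. $\lambda$ is Lebesgue measure on $[0,1]$ and $\gamma_*\omega(B)=\omega(\gamma^{-1}(B))$. $\mathcal P^{\mathrm{Acurve}}_L(\mathbb X)=\{\gamma_*(\rho\lambda):\gamma\in\mathrm{Lip}(\mathbb X),\,L(\gamma)\le L,\ \rho\lambda\in\mathcal P([0,1]),\ \rho\text{ Lipschitz with }L(\rho)\le L\}$ and $\mathcal P^{\mathrm{Lcurve}}_L(\mathbb X)=\{\gamma_*\lambda:\gamma\in\mathrm{Lip}(\mathbb X),\,L(\gamma)\le L\}$. *)

theory Defs
  imports "HOL-Analysis.Analysis" "HOL-Probability.Probability"
begin

definition curve_length :: "(real \<Rightarrow> 'a::metric_space) \<Rightarrow> ereal" where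
  "curve_length \<gamma> =
     (SUP p \<in> {(n::nat, t::nat \<Rightarrow> real). t 0 = 0 \<and> t n = 1 \<and> (\<forall>i<n. t i \<le> t (Suc i))}.
        ereal (\<Sum>i<fst p. dist (\<gamma> (snd p i)) (\<gamma> (snd p (Suc i)))))"

definition length_space :: "'a::metric_space itself \<Rightarrow> bool" where
  "length_space _ \<longleftrightarrow> (\<forall>x y::'a. ereal (dist x y) =
      (INF \<gamma> \<in> {\<gamma>. continuous_on {0..1} \<gamma> \<and> \<gamma> 0 = x \<and> \<gamma> 1 = y}. curve_length \<gamma>))"

definition ahlfors_regular :: "'a::metric_space measure \<Rightarrow> real \<Rightarrow> bool" where
  "ahlfors_regular \<sigma> d \<longleftrightarrow>
     sets \<sigma> = sets borel \<and> finite_measure \<sigma> \<and>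
     (\<forall>U. open U \<and> U \<noteq> {} \<longrightarrow> emeasure \<sigma> U > 0) \<and>
     (\<exists>C1 C2. C1 > 0 \<and> C2 > 0 \<and>
        (\<forall>x r. 0 < r \<and> r \<le> diameter (UNIV::'a set) \<longrightarrow>
           C1 * r powr d \<le> measure \<sigma> (cball x r) \<and> measure \<sigma> (cball x r) \<le> C2 * r powr d))"

definition prob_measures :: "'a::topological_space measure set" where
  "prob_measures = {\<mu>. prob_space \<mu> \<and> sets \<mu> = sets borel}"

definition pd_kernel :: "('a \<Rightarrow> 'a \<Rightarrow> real) \<Rightarrow> bool" where
  "pd_kernel K \<longleftrightarrow> (\<forall>x y. K x y = K y x) \<and>
     (\<forall>n (x::nat \<Rightarrow> 'a) (a::nat \<Rightarrow> real). (\<Sum>i<n. \<Sum>j<n. a i * a j * K (x i) (x j)) \<ge> 0)"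

definition discrepancy :: "('a \<Rightarrow> 'a \<Rightarrow> real) \<Rightarrow> 'a measure \<Rightarrow> 'a measure \<Rightarrow> real" where
  "discrepancy K \<mu> \<nu> = sqrt ((\<integral>x. (\<integral>y. K x y \<partial>\<mu>) \<partial>\<mu>) - 2 * (\<integral>x. (\<integral>y. K x y \<partial>\<nu>) \<partial>\<mu>)
        + (\<integral>x. (\<integral>y. K x y \<partial>\<nu>) \<partial>\<nu>))"

definition lebesgue01 :: "real measure" where
  "lebesgue01 = restrict_space lborel {0..1}"

definition closed_lip_curves :: "real \<Rightarrow> (real \<Rightarrow> 'a::metric_space) set" where
  "closed_lip_curves L = {\<gamma>. L-lipschitz_on {0..1} \<gamma> \<and> \<gamma> 0 = \<gamma> 1}"

definition P_Acurve :: "real \<Rightarrow> 'a::metric_space measure set" where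
  "P_Acurve L = {distr (density lebesgue01 (\<lambda>t. ennreal (\<rho> t))) borel \<gamma> | \<gamma> \<rho>.
      \<gamma> \<in> closed_lip_curves L \<and> L-lipschitz_on {0..1} \<rho> \<and> (\<forall>t\<in>{0..1}. \<rho> t \<ge> 0) \<and>
      prob_space (density lebesgue01 (\<lambda>t. ennreal (\<rho> t)))}"

definition P_Lcurve :: "real \<Rightarrow> 'a::metric_space measure set" where
  "P_Lcurve L = {distr lebesgue01 borel \<gamma> | \<gamma>. \<gamma> \<in> closed_lip_curves L}"

end

theory Submission
  imports Defs "HOL-Library.Diagonal_Subsequence"
begin

text \<open>
  Write \<open>D\<^sup>2\<close> for the squared discrepancy. A derandomised Monte Carlo argument gives \<open>N\<close> points whose
  empirical measure \<open>\<nu>\<close> satisfies \<open>D\<^sup>2(\<mu>, \<nu>) \<le> C / N\<close>. A maximal separated net of mesh \<open>r \<sim> N\<close> to the power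
  \<open>-1/d\<close> has \<open>O(N)\<close> points and becomes connected when points at distance \<open>2r\<close> are joined, so a closed walk
  with \<open>O(N)\<close> moves of size \<open>O(r)\<close> visits the net and all \<open>N\<close> points. The curve follows geodesics along
  this walk and additionally rests for \<open>k\<close> time steps at each of the \<open>N\<close> points. With \<open>m \<sim> N k\<close> time steps
  its speed is \<open>O(r m)\<close>, which is at most \<open>L\<close> for \<open>m \<sim> L / r\<close>, and the fraction of time not spent resting
  is \<open>\<theta> = O(N / m) = O(N r / L)\<close>. Hence the curve measure \<open>\<eta>\<close> has \<open>D\<^sup>2(\<nu>, \<eta>) = O(\<theta>\<^sup>2)\<close>. Choosing \<open>N\<close> as \<open>L\<close> to the
  power \<open>2d / (3d - 2)\<close> balances both errors. The minima exist by an Arzela-Ascoli argument.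
\<close>

text \<open>The exponent depends on the time share \<theta> entering squared. Testing the signed
  measure \<nu> - \<eta> against the kernel sections bounds its potential by a multiple of \<theta>;
  testing it again against that potential gains the second factor. A linear bound for
  \<open>D\<^sup>2\<close> would only lead to the exponent d / (4d - 2). With the square, the two
  errors agree when N^(3 - 2/d) is of order L^2. Three regimes escape the construction. The choice
  of N relies on d at least 1, which is not assumed: it is forced by connectedness as soon as the
  space has two points. In a one-point space all discrepancies vanish. For small L the speed limit
  may be too low for the walk, but then the trivial bound on the discrepancy suffices after
  enlarging the constant. All constants are fixed before \<mu> and L. This is why the points are
  picked by a deterministic inequality in which \<mu> enters only through uniform bounds on
  potentials and energies.\<close>

subsection \<open>Limits of asymptotically Lipschitz maps and geodesics\<close>

text \<open>The error \<open>e n\<close> admits discontinuous maps: approximate geodesics will be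
  step functions, whereas curves and densities are treated with \<open>e = 0\<close>. Pointwise
  convergence is enough, because the later limits of integrals come from dominated
  convergence.\<close>

lemma asymptotically_lipschitz_convergent_subseq:
  fixes f :: "nat \<Rightarrow> real \<Rightarrow> 'a::metric_space"
  assumes S: "compact S" and fS: "\<And>n t. t \<in> {0..1} \<Longrightarrow> f n t \<in> S"
    and L: "L \<ge> 0" and e: "e \<longlonglongrightarrow> 0"
    and lip: "\<And>n s t. s \<in> {0..1} \<Longrightarrow> t \<in> {0..1} \<Longrightarrow> dist (f n s) (f n t) \<le> L * \<bar>s - t\<bar> + e n"
  obtains r g where "strict_mono (r :: nat \<Rightarrow> nat)" "L-lipschitz_on {0..1} g"
    "\<And>t. t \<in> {0..1} \<Longrightarrow> (\<lambda>n. f (r n) t) \<longlonglongrightarrow> g t"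
proof -
  define Q :: "real set" where "Q = {0..1} \<inter> \<rat>"
  have "Q \<noteq> {}" using Rats_0 by (force simp: Q_def)
  moreover have "countable Q" unfolding Q_def using countable_rat by blast
  ultimately have "range (from_nat_into Q) = Q" by (rule range_from_nat_into)
  then obtain q :: "nat \<Rightarrow> real" where q: "range q = Q" by blast
  then have q01: "q k \<in> {0..1}" for k unfolding Q_def by blast
  \<comment> \<open>Diagonal extraction over an enumeration of the rationals in the unit interval;
    compactness of \<open>S\<close> supplies each single refinement.\<close>
  interpret subseqs "\<lambda>k s. convergent (\<lambda>n. f (s n) (q k))"
  proof
    fix k and s :: "nat \<Rightarrow> nat" assume "strict_mono s"
    obtain l r' where "strict_mono r'" "((\<lambda>n. f (s n) (q k)) \<circ> r') \<longlonglongrightarrow> l"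
      using seq_compactE[of S "\<lambda>n. f (s n) (q k)"] S compact_imp_seq_compact fS q01
      by metis
    then show "\<exists>r'. strict_mono r' \<and> convergent (\<lambda>n. f ((s \<circ> r') n) (q k))"
      by (auto simp: o_def convergent_def)
  qed
  define r where "r = diagseq"
  have r: "strict_mono r" by (simp add: r_def subseq_diagseq)
  have conv: "convergent (\<lambda>n. f (r n) (q k))" for k
  proof -
    \<comment> \<open>The diagonal sequence refines the extraction for \<open>q k\<close> only from
      index \<open>Suc k\<close> on; shifting the index back does not affect the limit.\<close>
    have "convergent (\<lambda>n. f ((diagseq \<circ> ((+) (Suc k))) n) (q k))"
    proof (rule diagseq_holds)
      fix r s :: "nat \<Rightarrow> nat" and n assume "strict_mono r" "convergent (\<lambda>i. f (s i) (q n))"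
      then show "convergent (\<lambda>i. f ((s \<circ> r) i) (q n))"
        using convergent_subseq_convergent[of "\<lambda>i. f (s i) (q n)" r] by (simp add: o_def)
    qed
    then have "convergent (\<lambda>n. f (r (n + Suc k)) (q k))"
      by (simp add: o_def r_def add.commute)
    then obtain l where "(\<lambda>n. f (r (n + Suc k)) (q k)) \<longlonglongrightarrow> l" by (auto simp: convergent_def)
    then have "(\<lambda>n. f (r n) (q k)) \<longlonglongrightarrow> l"
      using LIMSEQ_offset[of "\<lambda>n. f (r n) (q k)" "Suc k" l] by blast
    then show ?thesis by (auto simp: convergent_def)
  qed
  have er: "(\<lambda>n. e (r n)) \<longlonglongrightarrow> 0"
    using LIMSEQ_subseq_LIMSEQ[OF e r] by (simp add: o_def)
  have ex: "\<exists>l. (\<lambda>n. f (r n) t) \<longlonglongrightarrow> l" if t: "t \<in> {0..1}" for t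
  proof -
    have "Cauchy (\<lambda>n. f (r n) t)"
    proof (rule metric_CauchyI)
      fix \<epsilon> :: real assume \<epsilon>: "\<epsilon> > 0"
      \<comment> \<open>The estimate below has five parts: one distance at \<open>p\<close>, two
        Lipschitz terms and two errors \<open>e\<close>. Dividing by \<open>L + 1\<close> covers
        \<open>L = 0\<close>.\<close>
      define \<delta> where "\<delta> = \<epsilon> / 5 / (L + 1)"
      have L1: "L + 1 > 0" using L by simp
      have \<delta>: "\<delta> > 0" using \<epsilon> L1 by (simp add: \<delta>_def)
      obtain p where p: "p \<in> Q" "\<bar>p - t\<bar> < \<delta>"
      proof -
        have lt: "max 0 (t - \<delta>) < min 1 (t + \<delta>)" using t \<delta> by auto
        from Rats_dense_in_real[OF lt] obtain p where "p \<in> \<rat>" "max 0 (t - \<delta>) < p" "p < min 1 (t + \<delta>)"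
          by blast
        then show ?thesis using that[of p] by (auto simp: Q_def)
      qed
      then obtain k where k: "p = q k" using q by auto
      have L\<delta>: "L * \<bar>p - t\<bar> \<le> \<epsilon> / 5"
      proof -
        have "\<bar>p - t\<bar> * (L + 1) < \<epsilon> / 5"
          using p(2) unfolding \<delta>_def pos_less_divide_eq[OF L1] .
        moreover have "L * \<bar>p - t\<bar> \<le> \<bar>p - t\<bar> * (L + 1)" by (simp add: distrib_left)
        ultimately show ?thesis by linarith
      qed
      have "Cauchy (\<lambda>n. f (r n) p)" using conv[of k] k convergent_Cauchy by blast
      then obtain N1 where N1: "\<And>m n. m \<ge> N1 \<Longrightarrow> n \<ge> N1 \<Longrightarrow> dist (f (r m) p) (f (r n) p) < \<epsilon> / 5"
        using \<epsilon> metric_CauchyD[of "\<lambda>n. f (r n) p" "\<epsilon> / 5"] by auto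
      obtain N2 where N2: "\<And>n. n \<ge> N2 \<Longrightarrow> e (r n) < \<epsilon> / 5"
        using order_tendstoD(2)[OF er, of "\<epsilon> / 5"] \<epsilon> by (auto simp: eventually_sequentially)
      have "dist (f (r m) t) (f (r n) t) < \<epsilon>" if "m \<ge> max N1 N2" "n \<ge> max N1 N2" for m n
      proof -
        have p01: "p \<in> {0..1}" using p by (simp add: Q_def)
        have "dist (f (r m) t) (f (r n) t)
            \<le> dist (f (r m) p) (f (r m) t) + dist (f (r m) p) (f (r n) p) + dist (f (r n) p) (f (r n) t)"
          using dist_triangle[of "f (r m) t" "f (r n) t" "f (r m) p"]
            dist_triangle[of "f (r m) p" "f (r n) t" "f (r n) p"] by (simp add: dist_commute)
        moreover have "dist (f (r m) p) (f (r m) t) \<le> \<epsilon> / 5 + e (r m)"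
          using lip[OF p01 t, of "r m"] L\<delta> by linarith
        moreover have "dist (f (r n) p) (f (r n) t) \<le> \<epsilon> / 5 + e (r n)"
          using lip[OF p01 t, of "r n"] L\<delta> by linarith
        ultimately show ?thesis using N1[of m n] N2[of m] N2[of n] that by auto
      qed
      then show "\<exists>M. \<forall>m\<ge>M. \<forall>n\<ge>M. dist (f (r m) t) (f (r n) t) < \<epsilon>" by blast
    qed
    then show ?thesis using completeE[OF compact_imp_complete[OF S], of "\<lambda>n. f (r n) t"] fS[OF t] by blast
  qed
  then obtain g where g: "\<And>t. t \<in> {0..1} \<Longrightarrow> (\<lambda>n. f (r n) t) \<longlonglongrightarrow> g t" by metis
  have "L-lipschitz_on {0..1} g"
  proof (rule lipschitz_onI)
    fix s t :: real assume st: "s \<in> {0..1}" "t \<in> {0..1}"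
    have "(\<lambda>n. dist (f (r n) s) (f (r n) t)) \<longlonglongrightarrow> dist (g s) (g t)"
      by (intro tendsto_dist g st)
    moreover have "(\<lambda>n. L * \<bar>s - t\<bar> + e (r n)) \<longlonglongrightarrow> L * \<bar>s - t\<bar> + 0"
      by (intro tendsto_add tendsto_const er)
    ultimately show "dist (g s) (g t) \<le> L * dist s t"
      using LIMSEQ_le lip[OF st] by (fastforce simp: dist_real_def)
  qed (rule L)
  then show ?thesis using that r g by blast
qed

text \<open>A nearly shortest curve is sampled finely and the samples are run through at constant
  speed, measured by accumulated chord length. This replaces a reparametrisation by arc length; the
  price is that \<open>g\<close> jumps between samples, hence the additive
  \<open>\<eta>\<close>.\<close>

lemma approximate_geodesic:
  fixes x y :: "'a::metric_space"
  assumes len: "length_space TYPE('a)" and \<eta>: "\<eta> > 0"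
  shows "\<exists>g. g 0 = x \<and> g 1 = y \<and>
    (\<forall>s\<in>{0..1}. \<forall>t\<in>{0..1}. dist (g s) (g t) \<le> (dist x y + \<eta>) * \<bar>s - t\<bar> + \<eta>)"
proof -
  define l where "l = dist x y + \<eta>"
  have l: "l > 0" using \<eta> by (simp add: l_def add_nonneg_pos)
  have "(INF \<gamma> \<in> {\<gamma>. continuous_on {0..1} \<gamma> \<and> \<gamma> 0 = x \<and> \<gamma> 1 = y}. curve_length \<gamma>) < ereal l"
    using len \<eta> unfolding length_space_def l_def by (metis less_add_same_cancel1 less_ereal.simps(1))
  then obtain \<gamma> where \<gamma>: "continuous_on {0..1} \<gamma>" "\<gamma> 0 = x" "\<gamma> 1 = y" "curve_length \<gamma> < ereal l"
    by (auto simp: INF_less_iff)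
  have "uniformly_continuous_on {0..1} \<gamma>"
    using \<gamma>(1) compact_uniformly_continuous compact_Icc by blast
  then obtain \<delta> where \<delta>: "\<delta> > 0"
    "\<And>s t. s \<in> {0..1} \<Longrightarrow> t \<in> {0..1} \<Longrightarrow> dist t s < \<delta> \<Longrightarrow> dist (\<gamma> t) (\<gamma> s) < \<eta>"
    using \<eta> unfolding uniformly_continuous_on_def by metis
  obtain n :: nat where n: "n > 0" "1 / real n < \<delta>"
    using real_arch_inverse[of \<delta>] \<delta>(1) by (auto simp: inverse_eq_divide)
  define q where "q i = \<gamma> (real i / real n)" for i
  define a where "a i = (\<Sum>j<i. dist (q j) (q (Suc j)))" for i
  have a_mono: "a i \<le> a j" if "i \<le> j" for i j
    unfolding a_def by (rule sum_mono2) (use that in auto)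
  have step: "dist (q j) (q (Suc j)) \<le> \<eta>" if "j < n" for j
  proof -
    have "dist (real j / real n) (real (Suc j) / real n) < \<delta>"
      using n by (simp add: dist_real_def diff_divide_distrib[symmetric])
    then show ?thesis unfolding q_def using that n(1) by (intro less_imp_le \<delta>(2)) (auto simp: field_simps)
  qed
  have an: "a n \<le> l"
  proof -
    have "ereal (\<Sum>i<fst p. dist (\<gamma> (snd p i)) (\<gamma> (snd p (Suc i)))) \<le> curve_length \<gamma>"
      if "p = (n, \<lambda>i. real i / real n)" for p
      unfolding curve_length_def
      by (rule SUP_upper) (use n(1) that in \<open>auto simp: divide_right_mono\<close>)
    from this[OF refl] have "ereal (a n) \<le> curve_length \<gamma>" by (simp add: a_def q_def)
    then show ?thesis using \<gamma>(4) by (meson ereal_less_eq(3) le_less_trans less_imp_le)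
  qed
  \<comment> \<open>The last sample whose accumulated length fits into the length
    \<open>t * l\<close> available at time \<open>t\<close>.\<close>
  define m where "m t = Max {i. i \<le> n \<and> a i \<le> t * l}" for t
  have a0: "a 0 = 0" by (simp add: a_def)
  have mm: "m t \<le> n \<and> a (m t) \<le> t * l" if "t \<ge> 0" for t
  proof -
    have "0 \<in> {i. i \<le> n \<and> a i \<le> t * l}" using that l a0 by simp
    then have "m t \<in> {i. i \<le> n \<and> a i \<le> t * l}" unfolding m_def by (intro Max_in) auto
    then show ?thesis by simp
  qed
  have mge: "i \<le> m t" if "i \<le> n" "a i \<le> t * l" for i t
    unfolding m_def using that by (intro Max_ge) auto
  have dist_q: "dist (q i) (q j) \<le> a j - a i" if "i \<le> j" for i j
    using that
  proof (induction j rule: dec_induct)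
    case (step k)
    have "dist (q i) (q (Suc k)) \<le> dist (q i) (q k) + dist (q k) (q (Suc k))" by (rule dist_triangle)
    then show ?case using step.IH by (simp add: a_def)
  qed simp
  define g where "g t = q (m t)" for t
  have ordered: "dist (g s) (g t) \<le> l * (t - s) + \<eta>" if "0 \<le> s" "s \<le> t" for s t
  proof -
    have "s * l \<le> t * l" using that l by simp
    then have le: "m s \<le> m t" using mm[of s] that by (intro mge) auto
    show ?thesis
    proof (cases "m s = n")
      case True
      then have "m t = m s" using le mm[of t] that by auto
      then show ?thesis using \<eta> l that by (simp add: g_def)
    next
      case False
      then have lt: "m s < n" using mm[of s] that by auto
      \<comment> \<open>By maximality the next sample overshoots \<open>s * l\<close>, so
        \<open>a (m s)\<close> falls short of it by at most one chord. At the last sample there is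
        no successor, but there \<open>g\<close> no longer moves.\<close>
      then have "a (Suc (m s)) > s * l" using mge[of "Suc (m s)" s] by force
      moreover have "a (Suc (m s)) \<le> a (m s) + \<eta>" using step[OF lt] by (simp add: a_def)
      ultimately have "a (m s) \<ge> s * l - \<eta>" by simp
      moreover have "dist (g s) (g t) \<le> a (m t) - a (m s)" unfolding g_def using le by (rule dist_q)
      moreover have "a (m t) \<le> t * l" using mm that by auto
      ultimately show ?thesis by (simp add: algebra_simps)
    qed
  qed
  have "g 0 = x"
  proof -
    have "a (m 0) = 0" using mm[of 0] a_mono[of 0 "m 0"] a0 by auto
    then have "dist (q 0) (q (m 0)) \<le> 0" using dist_q[of 0 "m 0"] a0 by simp
    then show ?thesis using \<gamma>(2) by (simp add: g_def q_def)
  qed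
  moreover have "g 1 = y"
  proof -
    have "m 1 = n" using mge[of n 1] mm[of 1] an by auto
    then show ?thesis using \<gamma>(3) n(1) by (simp add: g_def q_def)
  qed
  moreover have "dist (g s) (g t) \<le> (dist x y + \<eta>) * \<bar>s - t\<bar> + \<eta>" if "s \<in> {0..1}" "t \<in> {0..1}" for s t
    using ordered[of s t] ordered[of t s] that
    by (cases "s \<le> t") (auto simp: l_def dist_commute abs_real_def)
  ultimately show ?thesis by blast
qed

lemma compact_length_space_geodesic:
  fixes x y :: "'a::metric_space"
  assumes compact: "compact (UNIV :: 'a set)" and len: "length_space TYPE('a)"
  shows "\<exists>g :: real \<Rightarrow> 'a. (dist x y)-lipschitz_on {0..1} g \<and> g 0 = x \<and> g 1 = y"
proof -
  define \<eta> where "\<eta> n = inverse (real (Suc n))" for n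
  have \<eta>: "\<eta> n > 0" for n by (simp add: \<eta>_def)
  have "\<forall>n. \<exists>g. g 0 = x \<and> g 1 = y \<and>
    (\<forall>s\<in>{0..1}. \<forall>t\<in>{0..1}. dist (g s) (g t) \<le> (dist x y + \<eta> n) * \<bar>s - t\<bar> + \<eta> n)"
    using approximate_geodesic[OF len \<eta>] by blast
  then obtain f where f: "\<And>n. f n 0 = x" "\<And>n. f n 1 = y"
    "\<And>n s t. s \<in> {0..1} \<Longrightarrow> t \<in> {0..1} \<Longrightarrow>
       dist (f n s) (f n t) \<le> (dist x y + \<eta> n) * \<bar>s - t\<bar> + \<eta> n"
    by metis
  have lim: "(\<lambda>n. 2 * \<eta> n) \<longlonglongrightarrow> 0"
    using tendsto_mult_right_zero[OF LIMSEQ_inverse_real_of_nat, of 2] by (simp add: \<eta>_def)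
  \<comment> \<open>Since times differ by at most 1, the excess speed costs at most
    \<open>\<eta> n\<close>; with the jump this makes \<open>2 * \<eta> n\<close>.\<close>
  have bound: "dist (f n s) (f n t) \<le> dist x y * \<bar>s - t\<bar> + 2 * \<eta> n"
    if st: "s \<in> {0..1}" "t \<in> {0..1}" for n s t
  proof -
    have "\<eta> n * \<bar>s - t\<bar> \<le> \<eta> n * 1" using st \<eta>[of n] by (intro mult_left_mono) (auto simp: abs_le_iff)
    then show ?thesis using f(3)[OF st, of n] by (simp add: distrib_right)
  qed
  obtain r g where rg: "strict_mono (r :: nat \<Rightarrow> nat)" "(dist x y)-lipschitz_on {0..1} g"
    "\<And>t. t \<in> {0..1} \<Longrightarrow> (\<lambda>n. f (r n) t) \<longlonglongrightarrow> g t"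
  proof (rule asymptotically_lipschitz_convergent_subseq[OF compact UNIV_I zero_le_dist lim bound])
  qed (use that in blast)+
  have "g 0 = x" "g 1 = y"
    using rg(3)[of 0] rg(3)[of 1] f(1,2) LIMSEQ_unique[OF tendsto_const] by force+
  with rg(2) show ?thesis by blast
qed

subsection \<open>Kernel energies of probability measures\<close>

definition kernel_energy :: "('a \<Rightarrow> 'a \<Rightarrow> real) \<Rightarrow> 'a measure \<Rightarrow> 'a measure \<Rightarrow> real" where
  "kernel_energy K \<mu> \<nu> = (\<integral>x. (\<integral>y. K x y \<partial>\<nu>) \<partial>\<mu>)"

lemma discrepancy_eq_sqrt_energy:
  "discrepancy K \<mu> \<nu> = sqrt (kernel_energy K \<mu> \<mu> - 2 * kernel_energy K \<mu> \<nu> + kernel_energy K \<nu> \<nu>)"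
  by (simp add: discrepancy_def kernel_energy_def)

lemma prob_measures_D:
  assumes "\<mu> \<in> prob_measures"
  shows "prob_space \<mu>" "sets \<mu> = sets borel" "space \<mu> = UNIV"
proof -
  show *: "prob_space \<mu>" "sets \<mu> = sets borel" using assms by (simp_all add: prob_measures_def)
  show "space \<mu> = UNIV" using sets_eq_imp_space_eq[OF *(2)] by simp
qed

lemma compact_bounded_continuous:
  fixes f :: "'a::metric_space \<Rightarrow> real"
  assumes "compact (UNIV :: 'a set)" "continuous_on UNIV f"
  shows "\<exists>B. \<forall>x. \<bar>f x\<bar> \<le> B"
  using compact_imp_bounded[OF compact_continuous_image[OF assms(2,1)]] by (auto simp: bounded_iff)

lemma prob_integrable_bounded:
  fixes f :: "'a::metric_space \<Rightarrow> real"
  assumes "\<mu> \<in> prob_measures" "f \<in> borel_measurable borel" "\<And>x. \<bar>f x\<bar> \<le> B"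
  shows "integrable \<mu> f"
proof -
  interpret prob_space \<mu> using prob_measures_D[OF assms(1)] by simp
  have "f \<in> borel_measurable \<mu>"
    using assms(2) measurable_cong_sets[OF prob_measures_D(2)[OF assms(1)] refl] by blast
  then show ?thesis by (rule integrable_const_bound[where B = B, rotated]) (use assms(3) in auto)
qed

lemma prob_integral_le:
  fixes f g :: "'a::metric_space \<Rightarrow> real"
  assumes "\<mu> \<in> prob_measures" "integrable \<mu> f" "\<And>x. \<bar>f x\<bar> \<le> B"
  shows "\<bar>\<integral>x. f x \<partial>\<mu>\<bar> \<le> B"
proof -
  interpret prob_space \<mu> using prob_measures_D[OF assms(1)] by simp
  have "\<bar>\<integral>x. f x \<partial>\<mu>\<bar> \<le> (\<integral>x. \<bar>f x\<bar> \<partial>\<mu>)" using integral_norm_bound[of \<mu> f] by simp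
  also have "\<dots> \<le> (\<integral>x. B \<partial>\<mu>)" using assms by (intro integral_mono) auto
  also have "\<dots> = B" by (simp add: prob_space)
  finally show ?thesis .
qed

text \<open>Balls of a finite cover are made disjoint by removing the earlier ones. A cell may
  thereby lose its centre \<open>c i\<close>, so centres are tied to cells by distance only.\<close>

lemma compact_borel_partition:
  fixes \<delta> :: real
  assumes "compact (UNIV :: 'a::metric_space set)" "\<delta> > 0"
  obtains n :: nat and c :: "nat \<Rightarrow> 'a::metric_space" and A where
    "\<And>i. A i \<in> sets borel" "\<And>i x. x \<in> A i \<Longrightarrow> dist (c i) x < \<delta>"
    "disjoint_family A" "(\<Union>i<n. A i) = UNIV"
proof -
  have "UNIV \<subseteq> (\<Union>x\<in>UNIV. ball (x::'a) \<delta>)"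
    using assms(2) by (metis UN_I UNIV_I centre_in_ball subsetI)
  with assms(1) obtain C :: "'a set" where C: "finite C" "UNIV \<subseteq> (\<Union>x\<in>C. ball x \<delta>)"
    using compactE_image[of UNIV UNIV "\<lambda>x. ball x \<delta>"] by auto
  obtain c :: "nat \<Rightarrow> 'a" and n where c: "C = c ` {i. i < n}"
    using C(1) finite_imp_nat_seg_image_inj_on by metis
  define A where "A = disjointed (\<lambda>i. ball (c i) \<delta>)"
  have "(\<Union>i<n. A i) = (\<Union>i<n. ball (c i) \<delta>)"
    using finite_UN_disjointed_eq[of "\<lambda>i. ball (c i) \<delta>" n] by (simp add: A_def atLeast0LessThan)
  then have "(\<Union>i<n. A i) = UNIV" using C(2) c by auto
  moreover have "A i \<in> sets borel" for i unfolding A_def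
    using sets.range_disjointed_sets[of "\<lambda>i. ball (c i) \<delta>" borel] by fastforce
  moreover have "dist (c i) x < \<delta>" if "x \<in> A i" for i x
    using that disjointed_subset[of "\<lambda>i. ball (c i) \<delta>" i] by (auto simp: A_def)
  moreover have "disjoint_family A" by (simp add: A_def disjoint_family_disjointed)
  ultimately show ?thesis using that by blast
qed

lemma prob_integral_partition_approx:
  fixes f :: "'a::metric_space \<Rightarrow> real" and n :: nat
  assumes \<mu>: "\<mu> \<in> prob_measures" and f: "f \<in> borel_measurable borel" "\<And>x. \<bar>f x\<bar> \<le> B"
    and A: "\<And>i. A i \<in> sets borel" "disjoint_family A" "(\<Union>i<n. A i) = UNIV"
    and osc: "\<And>i x. x \<in> A i \<Longrightarrow> \<bar>f x - f (c i)\<bar> \<le> e"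
  shows "\<bar>(\<integral>x. f x \<partial>\<mu>) - (\<Sum>i<n. measure \<mu> (A i) * f (c i))\<bar> \<le> e"
proof -
  interpret prob_space \<mu> using prob_measures_D[OF \<mu>] by simp
  have [measurable]: "A i \<in> sets \<mu>" for i using A(1) prob_measures_D[OF \<mu>] by simp
  define g where "g x = (\<Sum>i<n. indicator (A i) x * f (c i))" for x
  have ind: "integrable \<mu> (indicator (A i) :: 'a \<Rightarrow> real)" for i
    by (intro integrable_real_indicator) (auto simp: less_top[symmetric])
  have int_g: "(\<integral>x. g x \<partial>\<mu>) = (\<Sum>i<n. measure \<mu> (A i) * f (c i))"
    unfolding g_def by (subst Bochner_Integration.integral_sum) (use ind prob_measures_D(3)[OF \<mu>] in auto)
  have ig: "integrable \<mu> g" unfolding g_def by (intro Bochner_Integration.integrable_sum integrable_mult_left ind)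
  have if': "integrable \<mu> f" using prob_integrable_bounded[OF \<mu> f] .
  have "\<bar>f x - g x\<bar> \<le> e" for x
  proof -
    obtain i where i: "i < n" "x \<in> A i" using A(3) by auto
    have "x \<in> A j \<longleftrightarrow> j = i" for j using A(2) i by (auto simp: disjoint_family_on_def)
    then have "g x = (\<Sum>j<n. if j = i then f (c i) else 0)"
      unfolding g_def by (intro sum.cong) (auto simp: indicator_def)
    then have "g x = f (c i)" using i by simp
    then show ?thesis using osc i by simp
  qed
  then have "\<bar>\<integral>x. f x - g x \<partial>\<mu>\<bar> \<le> e" using if' ig by (intro prob_integral_le[OF \<mu>]) auto
  then show ?thesis using int_g if' ig by simp
qed

section \<open>Potentials and energies of a continuous positive definite kernel\<close>

locale compact_kernel =
  fixes K :: "'a::metric_space \<Rightarrow> 'a \<Rightarrow> real"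
  assumes compact_UNIV: "compact (UNIV :: 'a set)"
    and cont: "continuous_on UNIV (\<lambda>(x, y). K x y)"
    and pd: "pd_kernel K"
begin

lemma cont_left: "continuous_on UNIV (\<lambda>x. K x y)"
proof -
  have "continuous_on UNIV (\<lambda>x. (x, y))" by (intro continuous_intros)
  then show ?thesis using continuous_on_compose2[OF cont, of UNIV "\<lambda>x. (x, y)"] by simp
qed

lemma cont_right: "continuous_on UNIV (\<lambda>y. K x y)"
proof -
  have "continuous_on UNIV (\<lambda>y. (x, y))" by (intro continuous_intros)
  then show ?thesis using continuous_on_compose2[OF cont, of UNIV "\<lambda>y. (x, y)"] by simp
qed

lemma kernel_sym: "K x y = K y x"
  using pd by (simp add: pd_kernel_def)

lemma compact_UNIV_prod: "compact (UNIV :: ('a \<times> 'a) set)"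
  using compact_Times[OF compact_UNIV compact_UNIV] by simp

text \<open>A single bound on the kernel fixed for the whole locale, so that every later constant is
  independent of the measure and the curve. Requiring it to be at least 1 makes it positive even for
  the zero kernel.\<close>

definition M where "M = (SOME B. B \<ge> 1 \<and> (\<forall>x y. \<bar>K x y\<bar> \<le> B))"

lemma M_ge_1: "M \<ge> 1" and M_bound: "\<bar>K x y\<bar> \<le> M"
proof -
  obtain B where B: "\<And>p. \<bar>(\<lambda>(x, y). K x y) p\<bar> \<le> B"
    using compact_imp_bounded[OF compact_continuous_image[OF cont compact_UNIV_prod]]
    by (auto simp: bounded_iff)
  have "max B 1 \<ge> 1 \<and> (\<forall>x y. \<bar>K x y\<bar> \<le> max B 1)" using B by (force simp: le_max_iff_disj)
  then have "M \<ge> 1 \<and> (\<forall>x y. \<bar>K x y\<bar> \<le> M)" unfolding M_def by (rule someI)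
  then show "M \<ge> 1" "\<bar>K x y\<bar> \<le> M" by auto
qed

lemma kernel_uniform:
  assumes "e > 0"
  obtains \<delta> where "\<delta> > 0" "\<And>x x' y. dist x x' < \<delta> \<Longrightarrow> \<bar>K x y - K x' y\<bar> < e"
proof -
  have "uniformly_continuous_on UNIV (\<lambda>(x, y). K x y)"
    using compact_uniformly_continuous[OF cont compact_UNIV_prod] .
  then obtain \<delta> where \<delta>: "\<delta> > 0"
    "\<And>p p'. dist p' p < \<delta> \<Longrightarrow> dist (case p' of (x, y) \<Rightarrow> K x y) (case p of (x, y) \<Rightarrow> K x y) < e"
    using assms unfolding uniformly_continuous_on_def by (metis UNIV_I)
  have "\<bar>K x y - K x' y\<bar> < e" if "dist x x' < \<delta>" for x x' y
    using \<delta>(2)[of "(x, y)" "(x', y)"] that by (simp add: dist_Pair_Pair dist_real_def)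
  then show ?thesis using that \<delta>(1) by blast
qed

lemma kernel_integrable:
  assumes "\<nu> \<in> prob_measures"
  shows "integrable \<nu> (\<lambda>y. K x y)"
  using assms borel_measurable_continuous_onI[OF cont_right] M_bound by (rule prob_integrable_bounded)

lemma potential_bound:
  assumes "\<nu> \<in> prob_measures"
  shows "\<bar>\<integral>y. K x y \<partial>\<nu>\<bar> \<le> M"
  using prob_integral_le[OF assms kernel_integrable[OF assms] M_bound] .

lemma potential_uniform:
  assumes "\<nu> \<in> prob_measures" "\<And>y. \<bar>K x y - K x' y\<bar> \<le> e"
  shows "\<bar>(\<integral>y. K x y \<partial>\<nu>) - (\<integral>y. K x' y \<partial>\<nu>)\<bar> \<le> e"
proof -
  have "\<bar>\<integral>y. K x y - K x' y \<partial>\<nu>\<bar> \<le> e"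
    using assms by (intro prob_integral_le) (auto intro: kernel_integrable)
  then show ?thesis using kernel_integrable[OF assms(1)] by simp
qed

lemma potential_continuous:
  assumes "\<nu> \<in> prob_measures"
  shows "continuous_on UNIV (\<lambda>x. \<integral>y. K x y \<partial>\<nu>)"
  unfolding continuous_on_iff
proof (intro ballI allI impI)
  fix x :: 'a and e :: real assume "e > 0"
  then obtain \<delta> where \<delta>: "\<delta> > 0" "\<And>x x' y. dist x x' < \<delta> \<Longrightarrow> \<bar>K x y - K x' y\<bar> < e / 2"
    using kernel_uniform[of "e / 2"] by auto
  have "dist (\<integral>y. K x' y \<partial>\<nu>) (\<integral>y. K x y \<partial>\<nu>) < e" if "dist x' x < \<delta>" for x'
  proof -
    have "\<bar>(\<integral>y. K x' y \<partial>\<nu>) - (\<integral>y. K x y \<partial>\<nu>)\<bar> \<le> e / 2"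
      using \<delta>(2)[OF that] by (intro potential_uniform[OF assms]) (simp add: less_imp_le)
    then show ?thesis using \<open>e > 0\<close> by (simp add: dist_real_def)
  qed
  then show "\<exists>d>0. \<forall>x'\<in>UNIV. dist x' x < d \<longrightarrow> dist (\<integral>y. K x' y \<partial>\<nu>) (\<integral>y. K x y \<partial>\<nu>) < e"
    using \<delta>(1) by blast
qed

lemma potential_integrable:
  assumes "\<mu> \<in> prob_measures" "\<nu> \<in> prob_measures"
  shows "integrable \<mu> (\<lambda>x. \<integral>y. K x y \<partial>\<nu>)"
  using assms(1) borel_measurable_continuous_onI[OF potential_continuous[OF assms(2)]]
    potential_bound[OF assms(2)] by (rule prob_integrable_bounded)

lemma energy_bound:
  assumes "\<mu> \<in> prob_measures" "\<nu> \<in> prob_measures"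
  shows "\<bar>kernel_energy K \<mu> \<nu>\<bar> \<le> M"
  unfolding kernel_energy_def
  using prob_integral_le[OF assms(1) potential_integrable[OF assms] potential_bound[OF assms(2)]] .

text \<open>The type \<open>'a\<close> is not of class \<open>second_countable_topology\<close>, so the library does not give measurability
  of \<open>K\<close> for the product of the Borel algebras. Symmetry and positivity of the energy are therefore derived
  from finite Riemann sums instead of Fubini's theorem.\<close>

lemma energy_approx:
  assumes "e > 0"
  shows "\<exists>(n :: nat) c A. \<forall>\<mu>\<in>prob_measures. \<forall>\<nu>\<in>prob_measures.
    \<bar>kernel_energy K \<mu> \<nu> - (\<Sum>i<n. \<Sum>j<n. measure \<mu> (A i) * measure \<nu> (A j) * K (c i) (c j))\<bar> \<le> e"
proof -
  \<comment> \<open>The oscillation bound is uniform in the other argument, so the partition is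
    chosen before the measures. \<open>energy_psd\<close> needs one partition for several measures
    at once.\<close>
  obtain \<delta> where \<delta>: "\<delta> > 0" "\<And>x x' y. dist x x' < \<delta> \<Longrightarrow> \<bar>K x y - K x' y\<bar> < e / 2"
    using kernel_uniform[of "e / 2"] assms by auto
  obtain n :: nat and c :: "nat \<Rightarrow> 'a" and A where A:
    "\<And>i. A i \<in> sets borel" "\<And>i x. x \<in> A i \<Longrightarrow> dist (c i) x < \<delta>"
    "disjoint_family A" "(\<Union>i<n. A i) = UNIV"
    using compact_borel_partition[OF compact_UNIV \<delta>(1)] by metis
  have osc: "\<bar>K x y - K (c i) y\<bar> \<le> e / 2" if "x \<in> A i" for x i y
    using \<delta>(2)[of x "c i" y] A(2)[OF that] by (simp add: dist_commute)
  have "\<bar>kernel_energy K \<mu> \<nu> - (\<Sum>i<n. \<Sum>j<n. measure \<mu> (A i) * measure \<nu> (A j) * K (c i) (c j))\<bar> \<le> e"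
    if \<mu>: "\<mu> \<in> prob_measures" and \<nu>: "\<nu> \<in> prob_measures" for \<mu> \<nu>
  proof -
    \<comment> \<open>The inner integral is discretised first. Since the weights
      \<open>measure \<nu> (A j)\<close> sum to 1, \<open>h\<close> oscillates on each cell no more
      than \<open>K\<close> does, and the outer integral costs another \<open>e / 2\<close>.\<close>
    define h where "h x = (\<Sum>j<n. measure \<nu> (A j) * K x (c j))" for x
    have "\<bar>(\<integral>y. K x y \<partial>\<nu>) - h x\<bar> \<le> e / 2" for x unfolding h_def
      by (rule prob_integral_partition_approx[OF \<nu> borel_measurable_continuous_onI[OF cont_right] M_bound A(1,3,4)])
        (use osc in \<open>simp add: kernel_sym[of x]\<close>)
    note hx = this
    have "(\<lambda>x. \<integral>y. K x y \<partial>\<nu>) \<in> borel_measurable borel"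
      using potential_continuous[OF \<nu>] by (rule borel_measurable_continuous_onI)
    note hm = this
    have hc: "continuous_on UNIV h" unfolding h_def by (intro continuous_intros cont_left)
    obtain B where B: "\<And>x. \<bar>h x\<bar> \<le> B" using compact_bounded_continuous[OF compact_UNIV hc] by blast
    have ih: "integrable \<mu> h"
      using prob_integrable_bounded[OF \<mu> borel_measurable_continuous_onI[OF hc] B] .
    have "\<bar>\<integral>x. (\<integral>y. K x y \<partial>\<nu>) - h x \<partial>\<mu>\<bar> \<le> e / 2"
      using hx ih potential_integrable[OF \<mu> \<nu>] by (intro prob_integral_le[OF \<mu>]) auto
    then have 1: "\<bar>kernel_energy K \<mu> \<nu> - (\<integral>x. h x \<partial>\<mu>)\<bar> \<le> e / 2"
      using ih potential_integrable[OF \<mu> \<nu>] by (simp add: kernel_energy_def)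
    have "prob_space \<nu>" using prob_measures_D[OF \<nu>] by simp
    then interpret N: prob_space \<nu> .
    have sum1: "(\<Sum>j<n. measure \<nu> (A j)) = 1"
    proof -
      have "(\<Sum>j<n. measure \<nu> (A j)) = measure \<nu> (\<Union>j<n. A j)"
        using A(1) prob_measures_D[OF \<nu>] disjoint_family_on_mono[OF _ A(3), of "{..<n}"]
        by (intro N.finite_measure_finite_Union[symmetric]) auto
      then show ?thesis using A(4) prob_measures_D(3)[OF \<nu>] N.prob_space by simp
    qed
    have "\<bar>h x - h (c i)\<bar> \<le> e / 2" if "x \<in> A i" for i x
    proof -
      have "\<bar>h x - h (c i)\<bar> = \<bar>\<Sum>j<n. measure \<nu> (A j) * (K x (c j) - K (c i) (c j))\<bar>"
        by (simp add: h_def sum_subtractf right_diff_distrib)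
      also have "\<dots> \<le> (\<Sum>j<n. measure \<nu> (A j) * (e / 2))"
      proof (rule order_trans[OF sum_abs], rule sum_mono)
        fix j
        show "\<bar>measure \<nu> (A j) * (K x (c j) - K (c i) (c j))\<bar> \<le> measure \<nu> (A j) * (e / 2)"
          using mult_left_mono[OF osc[OF that, of "c j"] measure_nonneg, of \<nu> "A j"]
          by (simp only: abs_mult abs_of_nonneg[OF measure_nonneg])
      qed
      also have "\<dots> = e / 2" by (simp only: sum1 sum_distrib_right[symmetric] mult_1_left)
      finally show ?thesis .
    qed
    then have "\<bar>(\<integral>x. h x \<partial>\<mu>) - (\<Sum>i<n. measure \<mu> (A i) * h (c i))\<bar> \<le> e / 2"
      by (intro prob_integral_partition_approx[OF \<mu> borel_measurable_continuous_onI[OF hc] B A(1,3,4)])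
    moreover have "(\<Sum>i<n. measure \<mu> (A i) * h (c i)) =
        (\<Sum>i<n. \<Sum>j<n. measure \<mu> (A i) * measure \<nu> (A j) * K (c i) (c j))"
      by (simp add: h_def sum_distrib_left mult.assoc)
    ultimately show ?thesis using 1 by linarith
  qed
  then show ?thesis by blast
qed

lemma energy_sym:
  assumes "\<mu> \<in> prob_measures" "\<nu> \<in> prob_measures"
  shows "kernel_energy K \<mu> \<nu> = kernel_energy K \<nu> \<mu>"
proof -
  have "\<bar>kernel_energy K \<mu> \<nu> - kernel_energy K \<nu> \<mu>\<bar> \<le> e" if e: "e > 0" for e
  proof -
    obtain n :: nat and c :: "nat \<Rightarrow> 'a" and A where
      app: "\<And>\<mu> \<nu>. \<mu> \<in> prob_measures \<Longrightarrow> \<nu> \<in> prob_measures \<Longrightarrow>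
      \<bar>kernel_energy K \<mu> \<nu> - (\<Sum>i<n. \<Sum>j<n. measure \<mu> (A i) * measure \<nu> (A j) * K (c i) (c j))\<bar> \<le> e / 2"
      using energy_approx[OF half_gt_zero[OF e]] by meson
    have "(\<Sum>i<n. \<Sum>j<n. measure \<mu> (A i) * measure \<nu> (A j) * K (c i) (c j)) =
      (\<Sum>j<n. \<Sum>i<n. measure \<mu> (A i) * measure \<nu> (A j) * K (c i) (c j))"
      by (rule sum.swap)
    also have "\<dots> = (\<Sum>i<n. \<Sum>j<n. measure \<nu> (A i) * measure \<mu> (A j) * K (c i) (c j))"
      by (intro sum.cong refl) (simp add: kernel_sym mult.commute)
    finally show ?thesis using app[OF assms] app[OF assms(2,1)] by linarith
  qed
  then have "\<bar>kernel_energy K \<mu> \<nu> - kernel_energy K \<nu> \<mu>\<bar> \<le> 0" by (meson dense_ge)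
  then show ?thesis by simp
qed

text \<open>On a common partition the form becomes that of the point weights \<open>a i\<close>, the
  mass of the signed combination in cell \<open>A i\<close>, placed at the centres. There
  \<open>pd_kernel\<close> applies, and the discretisation error \<open>C * e\<close> is made
  arbitrarily small.\<close>

lemma energy_psd:
  assumes "\<And>p. p < N \<Longrightarrow> \<mu> p \<in> prob_measures"
  shows "(\<Sum>p<N. \<Sum>q<N. b p * b q * kernel_energy K (\<mu> p) (\<mu> q)) \<ge> 0" (is "?S \<ge> 0")
proof -
  define S where "S = ?S"
  define C where "C = (\<Sum>p<N. \<Sum>q<N. \<bar>b p * b q\<bar>)"
  have C: "C \<ge> 0" unfolding C_def by (intro sum_nonneg) auto
  have "0 \<le> S + C * e" if e: "e > 0" for e
  proof -
    obtain n :: nat and c :: "nat \<Rightarrow> 'a" and A where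
      app: "\<And>\<mu> \<nu>. \<mu> \<in> prob_measures \<Longrightarrow> \<nu> \<in> prob_measures \<Longrightarrow>
      \<bar>kernel_energy K \<mu> \<nu> - (\<Sum>i<n. \<Sum>j<n. measure \<mu> (A i) * measure \<nu> (A j) * K (c i) (c j))\<bar> \<le> e"
      using energy_approx[OF e] by meson
    define R where "R p q = (\<Sum>i<n. \<Sum>j<n. measure (\<mu> p) (A i) * measure (\<mu> q) (A j) * K (c i) (c j))" for p q
    define a where "a i = (\<Sum>p<N. b p * measure (\<mu> p) (A i))" for i
    have "(\<Sum>p<N. \<Sum>q<N. b p * b q * R p q) =
        (\<Sum>p<N. \<Sum>i<n. \<Sum>q<N. \<Sum>j<n. b p * b q * (measure (\<mu> p) (A i) * measure (\<mu> q) (A j) * K (c i) (c j)))"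
      unfolding R_def sum_distrib_left by (subst sum.swap[of _ "{..<n}" "{..<N}"]) simp
    also have "\<dots> = (\<Sum>i<n. \<Sum>p<N. \<Sum>j<n. \<Sum>q<N. b p * b q * (measure (\<mu> p) (A i) * measure (\<mu> q) (A j) * K (c i) (c j)))"
      by (subst sum.swap[of _ "{..<n}" "{..<N}"], subst (2) sum.swap) simp
    also have "\<dots> = (\<Sum>i<n. \<Sum>j<n. \<Sum>p<N. \<Sum>q<N. b p * b q * (measure (\<mu> p) (A i) * measure (\<mu> q) (A j) * K (c i) (c j)))"
      by (intro sum.cong refl sum.swap)
    also have "\<dots> = (\<Sum>i<n. \<Sum>j<n. a i * a j * K (c i) (c j))"
    proof (intro sum.cong refl)
      fix i j
      have "a i * a j * K (c i) (c j) = (\<Sum>p<N. \<Sum>q<N.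
          (b p * measure (\<mu> p) (A i)) * (b q * measure (\<mu> q) (A j)) * K (c i) (c j))"
        unfolding a_def sum_product by (simp only: sum_distrib_right)
      then show "(\<Sum>p<N. \<Sum>q<N. b p * b q * (measure (\<mu> p) (A i) * measure (\<mu> q) (A j) * K (c i) (c j))) =
          a i * a j * K (c i) (c j)"
        by (simp add: mult_ac)
    qed
    also have "\<dots> \<ge> 0" using pd unfolding pd_kernel_def by blast
    finally have pos: "(\<Sum>p<N. \<Sum>q<N. b p * b q * R p q) \<ge> 0" .
    have "\<bar>(\<Sum>p<N. \<Sum>q<N. b p * b q * R p q) - S\<bar>
        = \<bar>\<Sum>p<N. \<Sum>q<N. b p * b q * (R p q - kernel_energy K (\<mu> p) (\<mu> q))\<bar>"
      by (simp add: S_def sum_subtractf right_diff_distrib)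
    also have "\<dots> \<le> (\<Sum>p<N. \<Sum>q<N. \<bar>b p * b q\<bar> * e)"
    proof (rule order_trans[OF sum_abs], rule sum_mono, rule order_trans[OF sum_abs], rule sum_mono)
      fix p q assume "p \<in> {..<N}" "q \<in> {..<N}"
      then have "\<bar>R p q - kernel_energy K (\<mu> p) (\<mu> q)\<bar> \<le> e"
        using app[OF assms[of p] assms[of q]] by (simp add: R_def abs_minus_commute)
      then show "\<bar>b p * b q * (R p q - kernel_energy K (\<mu> p) (\<mu> q))\<bar> \<le> \<bar>b p * b q\<bar> * e"
        by (subst abs_mult) (intro mult_left_mono, auto)
    qed
    also have "\<dots> = C * e" by (simp add: C_def sum_distrib_right)
    finally show ?thesis using pos by linarith
  qed
  then have *: "- S \<le> C * e" if "e > 0" for e using that by fastforce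
  have "- S \<le> e" if "e > 0" for e
  proof -
    \<comment> \<open>Using \<open>C + 1\<close> avoids a case distinction for
      \<open>C = 0\<close>.\<close>
    have "- S \<le> C * (e / (C + 1))" using *[of "e / (C + 1)"] that C by simp
    also have "\<dots> \<le> e" using that C by (simp add: field_simps)
    finally show ?thesis .
  qed
  then have "- S \<le> 0" by (meson dense_ge)
  then show ?thesis by (simp add: S_def)
qed

definition dsq where
  "dsq \<mu> \<nu> = kernel_energy K \<mu> \<mu> - 2 * kernel_energy K \<mu> \<nu> + kernel_energy K \<nu> \<nu>"

lemma discrepancy_eq: "discrepancy K \<mu> \<nu> = sqrt (dsq \<mu> \<nu>)"
  by (simp add: dsq_def discrepancy_eq_sqrt_energy)

text \<open>Parallelogram identity: the right side minus the left side is the energy of the signed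
  measure \<mu> - 2\<nu> + \<eta>, nonnegative by \<open>energy_psd\<close>.\<close>

lemma dsq_triangle:
  assumes "\<mu> \<in> prob_measures" "\<nu> \<in> prob_measures" "\<eta> \<in> prob_measures"
  shows "dsq \<mu> \<eta> \<le> 2 * dsq \<mu> \<nu> + 2 * dsq \<nu> \<eta>"
proof -
  have "(\<Sum>p<3. \<Sum>q<3. [1, -2, 1] ! p * [1, -2, 1] ! q * kernel_energy K ([\<mu>, \<nu>, \<eta>] ! p) ([\<mu>, \<nu>, \<eta>] ! q)) \<ge> (0 :: real)"
    by (rule energy_psd) (use assms in \<open>auto simp: less_Suc_eq numeral_3_eq_3\<close>)
  then show ?thesis
    using energy_sym[OF assms(1,2)] energy_sym[OF assms(1,3)] energy_sym[OF assms(2,3)]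
    by (simp add: numeral_3_eq_3 dsq_def)
qed

lemma dsq_bound:
  assumes "\<mu> \<in> prob_measures" "\<nu> \<in> prob_measures"
  shows "\<bar>dsq \<mu> \<nu>\<bar> \<le> 4 * M"
  using energy_bound[OF assms] energy_bound[OF assms(1,1)] energy_bound[OF assms(2,2)]
  unfolding dsq_def by linarith

end

subsection \<open>Curve measures\<close>

definition curve_measure :: "(real \<Rightarrow> 'a::metric_space) \<Rightarrow> (real \<Rightarrow> real) \<Rightarrow> 'a measure" where
  "curve_measure \<gamma> \<rho> = distr (density lebesgue01 (\<lambda>t. ennreal (\<rho> t))) borel \<gamma>"

lemma space_lebesgue01: "space lebesgue01 = {0..1}"
  by (simp add: lebesgue01_def space_restrict_space)

lemma prob_space_lebesgue01: "prob_space lebesgue01"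
  unfolding lebesgue01_def
  by (rule prob_spaceI) (simp add: space_restrict_space emeasure_restrict_space)

lemma continuous_measurable_lebesgue01:
  fixes f :: "real \<Rightarrow> 'a::topological_space"
  assumes "continuous_on {0..1} f"
  shows "f \<in> measurable lebesgue01 borel"
  using borel_measurable_continuous_on_restrict[OF assms]
    measurable_cong_sets[OF sets_restrict_space_cong[OF sets_lborel, of "{0..1}"] refl]
  unfolding lebesgue01_def by blast

lemma density_one_lebesgue01: "density lebesgue01 (\<lambda>t. ennreal 1) = lebesgue01"
  by (simp add: density_1)

lemma P_Acurve_eq:
  "P_Acurve L = {curve_measure \<gamma> \<rho> | \<gamma> \<rho>. \<gamma> \<in> closed_lip_curves L \<and> L-lipschitz_on {0..1} \<rho> \<and>
     (\<forall>t\<in>{0..1}. \<rho> t \<ge> 0) \<and> prob_space (density lebesgue01 (\<lambda>t. ennreal (\<rho> t)))}"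
  by (simp add: P_Acurve_def curve_measure_def)

lemma P_Lcurve_eq: "P_Lcurve L = {curve_measure \<gamma> (\<lambda>_. 1) | \<gamma>. \<gamma> \<in> closed_lip_curves L}"
  by (simp add: P_Lcurve_def curve_measure_def density_1)

lemma integral_curve_measure:
  fixes f :: "'a::metric_space \<Rightarrow> real"
  assumes "continuous_on {0..1} \<gamma>" "continuous_on {0..1} \<rho>" "\<forall>t\<in>{0..1}. \<rho> t \<ge> 0"
    "continuous_on UNIV f"
  shows "(\<integral>x. f x \<partial>curve_measure \<gamma> \<rho>) = (\<integral>t. \<rho> t * f (\<gamma> t) \<partial>lebesgue01)"
proof -
  have m: "\<gamma> \<in> measurable lebesgue01 borel" "\<rho> \<in> borel_measurable lebesgue01" "f \<in> borel_measurable borel"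
    using assms by (auto intro: continuous_measurable_lebesgue01 borel_measurable_continuous_onI)
  have "(\<integral>x. f x \<partial>curve_measure \<gamma> \<rho>) = (\<integral>t. f (\<gamma> t) \<partial>density lebesgue01 (\<lambda>t. ennreal (\<rho> t)))"
    unfolding curve_measure_def using m by (intro integral_distr) auto
  also have "\<dots> = (\<integral>t. \<rho> t *\<^sub>R f (\<gamma> t) \<partial>lebesgue01)"
    using m assms(3) by (intro integral_density) (auto simp: space_lebesgue01 intro: measurable_compose)
  finally show ?thesis by simp
qed

text \<open>Expresses the normalisation of a density as an equation between integrals, which
  survives dominated convergence.\<close>

lemma prob_space_density_lebesgue01_iff:
  assumes "continuous_on {0..1} \<rho>" "\<forall>t\<in>{0..1}. \<rho> t \<ge> 0"
  shows "prob_space (density lebesgue01 (\<lambda>t. ennreal (\<rho> t))) \<longleftrightarrow> (\<integral>t. \<rho> t \<partial>lebesgue01) = 1"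
proof -
  interpret L: prob_space lebesgue01 by (rule prob_space_lebesgue01)
  have m: "\<rho> \<in> borel_measurable lebesgue01"
    using assms(1) by (rule continuous_measurable_lebesgue01)
  obtain B where B: "\<And>t. t \<in> {0..1} \<Longrightarrow> \<bar>\<rho> t\<bar> \<le> B"
    using compact_imp_bounded[OF compact_continuous_image[OF assms(1) compact_Icc]]
    unfolding bounded_iff by (metis imageI real_norm_def)
  have int: "integrable lebesgue01 \<rho>"
    by (rule L.integrable_const_bound[OF _ m, of B]) (use B in \<open>auto simp: space_lebesgue01\<close>)
  have ae: "AE t in lebesgue01. 0 \<le> \<rho> t" using assms(2) by (auto simp: space_lebesgue01)
  have "emeasure (density lebesgue01 (\<lambda>t. ennreal (\<rho> t))) {0..1}
      = (\<integral>\<^sup>+t. ennreal (\<rho> t) * indicator (space lebesgue01) t \<partial>lebesgue01)"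
    using m sets.top[of lebesgue01] by (subst emeasure_density) (auto simp: space_lebesgue01)
  also have "\<dots> = (\<integral>\<^sup>+t. ennreal (\<rho> t) \<partial>lebesgue01)"
    by (rule nn_integral_cong) simp
  also have "\<dots> = ennreal (\<integral>t. \<rho> t \<partial>lebesgue01)"
    using nn_integral_eq_integral[OF int ae] .
  finally have e: "emeasure (density lebesgue01 (\<lambda>t. ennreal (\<rho> t)))
      (space (density lebesgue01 (\<lambda>t. ennreal (\<rho> t)))) = ennreal (\<integral>t. \<rho> t \<partial>lebesgue01)"
    by (simp add: space_lebesgue01)
  have nn: "(\<integral>t. \<rho> t \<partial>lebesgue01) \<ge> 0" using ae by (rule integral_nonneg_AE)
  show ?thesis
  proof
    assume "prob_space (density lebesgue01 (\<lambda>t. ennreal (\<rho> t)))"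
    then have "ennreal (\<integral>t. \<rho> t \<partial>lebesgue01) = 1" using e prob_space.emeasure_space_1 by metis
    then show "(\<integral>t. \<rho> t \<partial>lebesgue01) = 1" using ennreal_eq_1 by blast
  next
    assume "(\<integral>t. \<rho> t \<partial>lebesgue01) = 1"
    then show "prob_space (density lebesgue01 (\<lambda>t. ennreal (\<rho> t)))" using e by (intro prob_spaceI) simp
  qed
qed

lemma curve_measure_prob:
  assumes "continuous_on {0..1} \<gamma>" "prob_space (density lebesgue01 (\<lambda>t. ennreal (\<rho> t)))"
  shows "curve_measure \<gamma> \<rho> \<in> prob_measures"
proof -
  have "\<gamma> \<in> measurable (density lebesgue01 (\<lambda>t. ennreal (\<rho> t))) borel"
    using continuous_measurable_lebesgue01[OF assms(1)] by simp
  then show ?thesis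
    unfolding prob_measures_def curve_measure_def using prob_space.prob_space_distr[OF assms(2)] by simp
qed

lemma closed_lip_curves_continuous:
  "\<gamma> \<in> closed_lip_curves L \<Longrightarrow> continuous_on {0..1} \<gamma>"
  unfolding closed_lip_curves_def by (auto intro: lipschitz_on_continuous_on)

lemma P_Lcurve_subset_P_Acurve:
  assumes "L \<ge> 0"
  shows "P_Lcurve L \<subseteq> P_Acurve L"
proof -
  have "L-lipschitz_on {0..1} (\<lambda>_. 1 :: real)" using assms by (auto intro: lipschitz_onI)
  then show ?thesis
    unfolding P_Acurve_eq P_Lcurve_eq using prob_space_lebesgue01 density_one_lebesgue01 by fastforce
qed

lemma P_Acurve_subset_prob: "P_Acurve L \<subseteq> prob_measures"
  unfolding P_Acurve_eq using closed_lip_curves_continuous curve_measure_prob by blast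

lemma P_Lcurve_nonempty:
  assumes "L \<ge> 0"
  shows "P_Lcurve L \<noteq> {}"
proof -
  have "(\<lambda>_. undefined) \<in> closed_lip_curves L"
    using assms unfolding closed_lip_curves_def by (auto intro: lipschitz_onI)
  then show ?thesis unfolding P_Lcurve_eq by blast
qed

text \<open>A density has mean 1 and oscillates by at most \<open>L\<close> on the unit interval.
  The bound provides both the compact range for extracting subsequences of densities and the
  dominating constant.\<close>

lemma probability_density_bound:
  assumes \<rho>: "L-lipschitz_on {0..1} \<rho>" "\<forall>t\<in>{0..1}. \<rho> t \<ge> 0"
    "prob_space (density lebesgue01 (\<lambda>t. ennreal (\<rho> t)))" and t: "t \<in> {0..1}"
  shows "\<rho> t \<le> 1 + L"
proof (rule ccontr)
  interpret L: prob_space lebesgue01 by (rule prob_space_lebesgue01)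
  assume "\<not> \<rho> t \<le> 1 + L"
  then have gt: "\<rho> t - L > 1" by simp
  have L0: "L \<ge> 0" using \<rho>(1) by (rule lipschitz_on_nonneg)
  have c: "continuous_on {0..1} \<rho>" using \<rho>(1) by (rule lipschitz_on_continuous_on)
  have ge: "\<rho> s \<ge> \<rho> t - L" if "s \<in> {0..1}" for s
  proof -
    have "\<bar>\<rho> t - \<rho> s\<bar> \<le> L * \<bar>t - s\<bar>" using lipschitz_onD[OF \<rho>(1) t that] by (simp add: dist_real_def)
    also have "\<dots> \<le> L * 1" using t that L0 by (intro mult_left_mono) (auto simp: abs_le_iff)
    finally show ?thesis by simp
  qed
  have one: "(\<integral>s. \<rho> s \<partial>lebesgue01) = 1" using prob_space_density_lebesgue01_iff[OF c \<rho>(2)] \<rho>(3) by simp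
  \<comment> \<open>The integral of a non-integrable function is 0 by convention, so the value 1
    already implies integrability.\<close>
  then have "integrable lebesgue01 \<rho>" using not_integrable_integral_eq by fastforce
  then have "(\<integral>s. \<rho> t - L \<partial>lebesgue01) \<le> (\<integral>s. \<rho> s \<partial>lebesgue01)"
    by (intro integral_mono) (auto simp: space_lebesgue01 ge)
  then show False using one gt by (simp add: L.prob_space)
qed

lemma weighted_integral_curve_tendsto:
  fixes f :: "nat \<Rightarrow> real \<Rightarrow> real"
  assumes "\<And>n. f n \<in> borel_measurable lebesgue01" "\<And>n t. t \<in> {0..1} \<Longrightarrow> \<bar>f n t\<bar> \<le> B"
    "\<And>t. t \<in> {0..1} \<Longrightarrow> (\<lambda>n. f n t) \<longlonglongrightarrow> g t" "g \<in> borel_measurable lebesgue01"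
  shows "(\<lambda>n. \<integral>t. f n t \<partial>lebesgue01) \<longlonglongrightarrow> (\<integral>t. g t \<partial>lebesgue01)"
proof -
  interpret L: prob_space lebesgue01 by (rule prob_space_lebesgue01)
  show ?thesis
    by (rule integral_dominated_convergence[where w = "\<lambda>_. B"])
      (use assms in \<open>auto simp: space_lebesgue01\<close>)
qed

section \<open>Continuity of the discrepancy in the curve and its density\<close>

context compact_kernel
begin

lemma dsq_curve_measure_tendsto:
  assumes \<mu>: "\<mu> \<in> prob_measures"
    and \<gamma>: "\<And>n. \<gamma> n \<in> closed_lip_curves L" "\<gamma>' \<in> closed_lip_curves L"
    and \<rho>: "\<And>n. L-lipschitz_on {0..1} (\<rho> n)" "\<And>n. \<forall>t\<in>{0..1}. \<rho> n t \<ge> 0"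
      "\<And>n. prob_space (density lebesgue01 (\<lambda>t. ennreal (\<rho> n t)))"
    and \<rho>': "L-lipschitz_on {0..1} \<rho>'"
    and lim: "\<And>t. t \<in> {0..1} \<Longrightarrow> (\<lambda>n. \<gamma> n t) \<longlonglongrightarrow> \<gamma>' t" "\<And>t. t \<in> {0..1} \<Longrightarrow> (\<lambda>n. \<rho> n t) \<longlonglongrightarrow> \<rho>' t"
  shows "\<forall>t\<in>{0..1}. \<rho>' t \<ge> 0" "prob_space (density lebesgue01 (\<lambda>t. ennreal (\<rho>' t)))"
    "(\<lambda>n. dsq \<mu> (curve_measure (\<gamma> n) (\<rho> n))) \<longlonglongrightarrow> dsq \<mu> (curve_measure \<gamma>' \<rho>')"
proof -
  have c\<rho>: "continuous_on {0..1} (\<rho> n)" "continuous_on {0..1} \<rho>'" for n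
    using \<rho>(1) \<rho>' lipschitz_on_continuous_on by blast+
  have c\<gamma>: "continuous_on {0..1} (\<gamma> n)" "continuous_on {0..1} \<gamma>'" for n
    using \<gamma> closed_lip_curves_continuous by blast+
  have bd: "\<bar>\<rho> n t\<bar> \<le> 1 + L" if "t \<in> {0..1}" for n t
    using probability_density_bound[OF \<rho> that] \<rho>(2) that by auto
  show nn: "\<forall>t\<in>{0..1}. \<rho>' t \<ge> 0"
    using \<rho>(2) lim(2) by (meson LIMSEQ_le_const)
  have "(\<lambda>n. \<integral>t. \<rho> n t \<partial>lebesgue01) \<longlonglongrightarrow> (\<integral>t. \<rho>' t \<partial>lebesgue01)"
    using bd lim(2) by (intro weighted_integral_curve_tendsto continuous_measurable_lebesgue01 c\<rho>) auto
  moreover have "(\<integral>t. \<rho> n t \<partial>lebesgue01) = 1" for n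
    using prob_space_density_lebesgue01_iff[OF c\<rho>(1) \<rho>(2)] \<rho>(3) by simp
  ultimately have "(\<integral>t. \<rho>' t \<partial>lebesgue01) = 1" by (simp add: LIMSEQ_const_iff)
  then show p': "prob_space (density lebesgue01 (\<lambda>t. ennreal (\<rho>' t)))"
    using prob_space_density_lebesgue01_iff[OF c\<rho>(2) nn] by simp
  define N where "N n = curve_measure (\<gamma> n) (\<rho> n)" for n
  define N' where "N' = curve_measure \<gamma>' \<rho>'"
  have N: "N n \<in> prob_measures" "N' \<in> prob_measures" for n
    unfolding N_def N'_def using c\<gamma> \<rho>(3) p' by (auto intro: curve_measure_prob)
  \<comment> \<open>The integrand varies with \<open>n\<close> as well: in the self-energy it is the
    potential of the very measure it is integrated against.\<close>
  have int_lim: "(\<lambda>n. \<integral>x. f n x \<partial>N n) \<longlonglongrightarrow> (\<integral>x. g x \<partial>N')"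
    if f: "\<And>n. continuous_on UNIV (f n)" "continuous_on UNIV g" "\<And>n x. \<bar>f n x\<bar> \<le> M"
      and flim: "\<And>t. t \<in> {0..1} \<Longrightarrow> (\<lambda>n. f n (\<gamma> n t)) \<longlonglongrightarrow> g (\<gamma>' t)" for f :: "nat \<Rightarrow> 'a \<Rightarrow> real" and g
  proof -
    have "(\<lambda>n. \<integral>t. \<rho> n t * f n (\<gamma> n t) \<partial>lebesgue01) \<longlonglongrightarrow> (\<integral>t. \<rho>' t * g (\<gamma>' t) \<partial>lebesgue01)"
    proof (rule weighted_integral_curve_tendsto)
      show "(\<lambda>t. \<rho> n t * f n (\<gamma> n t)) \<in> borel_measurable lebesgue01" for n
        by (intro continuous_measurable_lebesgue01 continuous_intros c\<rho> continuous_on_compose2[OF f(1) c\<gamma>(1)]) auto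
      show "(\<lambda>t. \<rho>' t * g (\<gamma>' t)) \<in> borel_measurable lebesgue01"
        by (intro continuous_measurable_lebesgue01 continuous_intros c\<rho> continuous_on_compose2[OF f(2) c\<gamma>(2)]) auto
      show "\<bar>\<rho> n t * f n (\<gamma> n t)\<bar> \<le> (1 + L) * M" if "t \<in> {0..1}" for n t
        unfolding abs_mult using bd[OF that] f(3) by (intro mult_mono) (auto intro: order_trans[OF abs_ge_zero])
      show "(\<lambda>n. \<rho> n t * f n (\<gamma> n t)) \<longlonglongrightarrow> \<rho>' t * g (\<gamma>' t)" if "t \<in> {0..1}" for t
        by (intro tendsto_mult lim flim that)
    qed
    then show ?thesis unfolding N_def N'_def
      using integral_curve_measure[OF c\<gamma>(1) c\<rho>(1) \<rho>(2) f(1)] integral_curve_measure[OF c\<gamma>(2) c\<rho>(2) nn f(2)]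
      by simp
  qed
  have Klim: "(\<lambda>n. K (x n) (y n)) \<longlonglongrightarrow> K x' y'" if "x \<longlonglongrightarrow> x'" "y \<longlonglongrightarrow> y'" for x y x' y'
    using continuous_on_tendsto_compose[OF cont tendsto_Pair[OF that]] by simp
  have pot: "(\<lambda>n. \<integral>y. K (x n) y \<partial>N n) \<longlonglongrightarrow> (\<integral>y. K x' y \<partial>N')" if "x \<longlonglongrightarrow> x'" for x x'
    by (intro int_lim cont_right M_bound Klim that lim)
  have "(\<lambda>n. kernel_energy K (N n) (N n)) \<longlonglongrightarrow> kernel_energy K N' N'"
    unfolding kernel_energy_def by (intro int_lim potential_continuous potential_bound pot lim N)
  \<comment> \<open>With \<mu> innermost the integrand is one fixed continuous potential; symmetry
    of the energy brings the cross term of \<open>dsq\<close> into this form.\<close>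
  moreover have "(\<lambda>n. kernel_energy K (N n) \<mu>) \<longlonglongrightarrow> kernel_energy K N' \<mu>"
    unfolding kernel_energy_def
    by (intro int_lim potential_continuous potential_bound \<mu>
        continuous_on_tendsto_compose[OF potential_continuous[OF \<mu>]] lim) auto
  ultimately show "(\<lambda>n. dsq \<mu> (curve_measure (\<gamma> n) (\<rho> n))) \<longlonglongrightarrow> dsq \<mu> (curve_measure \<gamma>' \<rho>')"
    unfolding dsq_def N_def[symmetric] N'_def[symmetric] energy_sym[OF \<mu> N(1)] energy_sym[OF \<mu> N(2)]
    by (intro tendsto_intros)
qed

end

subsection \<open>Minimizers and empirical measures\<close>

text \<open>Compactness is asked only of the set of values, so no topology on the measures is
  required.\<close>

lemma subsequentially_compact_attains_min:
  fixes F :: "'b \<Rightarrow> real"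
  assumes "S \<noteq> {}"
    and "\<And>u :: nat \<Rightarrow> 'b. (\<And>n. u n \<in> S) \<Longrightarrow>
      \<exists>r. \<exists>\<nu>\<in>S. strict_mono (r :: nat \<Rightarrow> nat) \<and> (\<lambda>n. F (u (r n))) \<longlonglongrightarrow> F \<nu>"
  shows "\<exists>\<nu>\<in>S. \<forall>\<nu>'\<in>S. F \<nu> \<le> F \<nu>'"
proof -
  have "seq_compact (F ` S)"
  proof (rule seq_compactI)
    fix v :: "nat \<Rightarrow> real" assume "\<forall>n. v n \<in> F ` S"
    then have "\<forall>n. \<exists>s. s \<in> S \<and> v n = F s" by blast
    then obtain u where u: "\<And>n. u n \<in> S" "\<And>n. v n = F (u n)" by metis
    obtain r \<nu> where "\<nu> \<in> S" "strict_mono (r :: nat \<Rightarrow> nat)" "(\<lambda>n. F (u (r n))) \<longlonglongrightarrow> F \<nu>"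
      using assms(2)[of u] u(1) by blast
    then show "\<exists>l\<in>F ` S. \<exists>r. strict_mono r \<and> (v \<circ> r) \<longlonglongrightarrow> l"
      unfolding o_def u(2) by blast
  qed
  then have "compact (F ` S)" by (simp add: compact_eq_seq_compact_metric)
  then show ?thesis using compact_attains_inf[of "F ` S"] assms(1) by auto
qed

lemma closed_lip_curves_convergent_subseq:
  fixes \<gamma> :: "nat \<Rightarrow> real \<Rightarrow> 'a::metric_space"
  assumes "compact (UNIV :: 'a set)" "L \<ge> 0" "\<And>n. \<gamma> n \<in> closed_lip_curves L"
  shows "\<exists>r. \<exists>\<gamma>'\<in>closed_lip_curves L. strict_mono (r :: nat \<Rightarrow> nat) \<and>
    (\<forall>t\<in>{0..1}. (\<lambda>n. \<gamma> (r n) t) \<longlonglongrightarrow> \<gamma>' t)"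
proof -
  have bound: "dist (\<gamma> n s) (\<gamma> n t) \<le> L * \<bar>s - t\<bar> + 0" if "s \<in> {0..1}" "t \<in> {0..1}" for n s t
    using assms(3)[of n] lipschitz_onD[OF _ that, of L "\<gamma> n"] by (simp add: closed_lip_curves_def dist_real_def)
  obtain r \<gamma>' where r: "strict_mono (r :: nat \<Rightarrow> nat)" "L-lipschitz_on {0..1} \<gamma>'"
    "\<And>t. t \<in> {0..1} \<Longrightarrow> (\<lambda>n. \<gamma> (r n) t) \<longlonglongrightarrow> \<gamma>' t"
  proof (rule asymptotically_lipschitz_convergent_subseq[where f = \<gamma>, OF assms(1) UNIV_I assms(2) tendsto_const bound])
  qed (use that in blast)+
  have "\<gamma> (r n) 0 = \<gamma> (r n) 1" for n using assms(3) by (simp add: closed_lip_curves_def)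
  then have "\<gamma>' 0 = \<gamma>' 1" using LIMSEQ_unique[OF r(3)[of 0]] r(3)[of 1] by simp
  then show ?thesis using r unfolding closed_lip_curves_def by blast
qed

context compact_kernel
begin

lemma P_Lcurve_attains_min:
  assumes \<mu>: "\<mu> \<in> prob_measures" and L: "L \<ge> 0"
  shows "\<exists>\<nu>\<in>P_Lcurve L. \<forall>\<nu>'\<in>P_Lcurve L. dsq \<mu> \<nu> \<le> dsq \<mu> \<nu>'"
proof (rule subsequentially_compact_attains_min)
  show "P_Lcurve L \<noteq> ({} :: 'a measure set)" using L by (rule P_Lcurve_nonempty)
next
  fix u :: "nat \<Rightarrow> 'a measure" assume "\<And>n. u n \<in> P_Lcurve L"
  then have "\<forall>n. \<exists>\<gamma>. \<gamma> \<in> closed_lip_curves L \<and> u n = curve_measure \<gamma> (\<lambda>_. 1)"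
    unfolding P_Lcurve_eq by blast
  then obtain \<gamma> where \<gamma>: "\<And>n. \<gamma> n \<in> closed_lip_curves L" "\<And>n. u n = curve_measure (\<gamma> n) (\<lambda>_. 1)"
    by metis
  obtain r \<gamma>' where r: "\<gamma>' \<in> closed_lip_curves L" "strict_mono (r :: nat \<Rightarrow> nat)"
    "\<And>t. t \<in> {0..1} \<Longrightarrow> (\<lambda>n. \<gamma> (r n) t) \<longlonglongrightarrow> \<gamma>' t"
    using closed_lip_curves_convergent_subseq[OF compact_UNIV L, of \<gamma>] \<gamma>(1) by blast
  have one: "L-lipschitz_on {0..1} (\<lambda>_. 1 :: real)" using L by (auto intro: lipschitz_onI)
  have p: "prob_space (density lebesgue01 (\<lambda>t. ennreal 1))"
    using prob_space_lebesgue01 by (simp add: density_1)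
  have "(\<lambda>n. dsq \<mu> (u (r n))) \<longlonglongrightarrow> dsq \<mu> (curve_measure \<gamma>' (\<lambda>_. 1))"
    unfolding \<gamma>(2) using dsq_curve_measure_tendsto(3)[OF \<mu> \<gamma>(1) r(1) one _ p one r(3)] by simp
  then show "\<exists>r. \<exists>\<nu>\<in>P_Lcurve L. strict_mono (r :: nat \<Rightarrow> nat) \<and> (\<lambda>n. dsq \<mu> (u (r n))) \<longlonglongrightarrow> dsq \<mu> \<nu>"
    using r(1,2) unfolding P_Lcurve_eq by blast
qed

lemma P_Acurve_attains_min:
  assumes \<mu>: "\<mu> \<in> prob_measures" and L: "L \<ge> 0"
  shows "\<exists>\<nu>\<in>P_Acurve L. \<forall>\<nu>'\<in>P_Acurve L. dsq \<mu> \<nu> \<le> dsq \<mu> \<nu>'"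
proof (rule subsequentially_compact_attains_min)
  show "P_Acurve L \<noteq> ({} :: 'a measure set)"
    using P_Lcurve_nonempty[OF L] P_Lcurve_subset_P_Acurve[OF L] by blast
next
  fix u :: "nat \<Rightarrow> 'a measure" assume "\<And>n. u n \<in> P_Acurve L"
  then have "\<forall>n. \<exists>\<gamma> \<rho>. u n = curve_measure \<gamma> \<rho> \<and> \<gamma> \<in> closed_lip_curves L \<and> L-lipschitz_on {0..1} \<rho> \<and>
     (\<forall>t\<in>{0..1}. \<rho> t \<ge> 0) \<and> prob_space (density lebesgue01 (\<lambda>t. ennreal (\<rho> t)))"
    unfolding P_Acurve_eq by blast
  then obtain \<gamma> \<rho> where u: "\<And>n. u n = curve_measure (\<gamma> n) (\<rho> n)"
    and \<gamma>: "\<And>n. \<gamma> n \<in> closed_lip_curves L"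
    and \<rho>: "\<And>n. L-lipschitz_on {0..1} (\<rho> n)" "\<And>n. \<forall>t\<in>{0..1}. \<rho> n t \<ge> 0"
      "\<And>n. prob_space (density lebesgue01 (\<lambda>t. ennreal (\<rho> n t)))"
    by metis
  obtain r \<gamma>' where r: "\<gamma>' \<in> closed_lip_curves L" "strict_mono (r :: nat \<Rightarrow> nat)"
    "\<And>t. t \<in> {0..1} \<Longrightarrow> (\<lambda>n. \<gamma> (r n) t) \<longlonglongrightarrow> \<gamma>' t"
    using closed_lip_curves_convergent_subseq[OF compact_UNIV L, of \<gamma>] \<gamma> by blast
  have range: "\<rho> (r n) t \<in> {0..1 + L}" if "t \<in> {0..1}" for n t
    using probability_density_bound[OF \<rho> that] \<rho>(2) that by simp
  have bound: "dist (\<rho> (r n) s) (\<rho> (r n) t) \<le> L * \<bar>s - t\<bar> + 0" if "s \<in> {0..1}" "t \<in> {0..1}" for n s t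
    using lipschitz_onD[OF \<rho>(1) that] by (simp add: dist_real_def)
  \<comment> \<open>A second extraction, for the densities, along the subsequence already chosen for
    the curves.\<close>
  obtain r' \<rho>' where r': "strict_mono (r' :: nat \<Rightarrow> nat)" "L-lipschitz_on {0..1} \<rho>'"
    "\<And>t. t \<in> {0..1} \<Longrightarrow> (\<lambda>n. \<rho> (r (r' n)) t) \<longlonglongrightarrow> \<rho>' t"
  proof (rule asymptotically_lipschitz_convergent_subseq[where f = "\<lambda>n. \<rho> (r n)", OF compact_Icc range L tendsto_const bound])
  qed (use that in blast)+
  have lim: "(\<lambda>n. \<gamma> (r (r' n)) t) \<longlonglongrightarrow> \<gamma>' t" if "t \<in> {0..1}" for t
    using LIMSEQ_subseq_LIMSEQ[OF r(3)[OF that] r'(1)] by (simp add: o_def)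
  note res = dsq_curve_measure_tendsto[OF \<mu> \<gamma> r(1) \<rho> r'(2) lim r'(3)]
  have "curve_measure \<gamma>' \<rho>' \<in> P_Acurve L" unfolding P_Acurve_eq using r(1) r'(2) res(1,2) by blast
  moreover have "strict_mono (r \<circ> r')" using r(2) r'(1) by (rule strict_mono_o)
  moreover have "(\<lambda>n. dsq \<mu> (u ((r \<circ> r') n))) \<longlonglongrightarrow> dsq \<mu> (curve_measure \<gamma>' \<rho>')"
    using res(3) by (simp add: u)
  ultimately show "\<exists>r. \<exists>\<nu>\<in>P_Acurve L. strict_mono (r :: nat \<Rightarrow> nat) \<and> (\<lambda>n. dsq \<mu> (u (r n))) \<longlonglongrightarrow> dsq \<mu> \<nu>"
    by blast
qed

end

text \<open>As the image of the uniform law on indices, it counts repeated points with multiplicity,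
  and every map \<open>x\<close> on the indices is measurable.\<close>

definition empirical_measure :: "nat \<Rightarrow> (nat \<Rightarrow> 'a::metric_space) \<Rightarrow> 'a measure" where
  "empirical_measure N x = distr (measure_pmf (pmf_of_set {..<N})) borel x"

lemma empirical_measure_prob: "empirical_measure N x \<in> prob_measures"
  unfolding prob_measures_def empirical_measure_def
  by (simp add: prob_space.prob_space_distr[OF prob_space_measure_pmf])

lemma integral_empirical_measure:
  fixes f :: "'a::metric_space \<Rightarrow> real"
  assumes "N > 0" "continuous_on UNIV f"
  shows "(\<integral>y. f y \<partial>empirical_measure N x) = (\<Sum>i<N. f (x i)) / N"
proof -
  have "f \<in> borel_measurable borel" using assms(2) by (rule borel_measurable_continuous_onI)
  then have "(\<integral>y. f y \<partial>empirical_measure N x) = (\<integral>i. f (x i) \<partial>measure_pmf (pmf_of_set {..<N}))"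
    unfolding empirical_measure_def by (intro integral_distr) auto
  also have "\<dots> = (\<Sum>i<N. f (x i)) / N"
    using assms(1) by (subst integral_pmf_of_set) auto
  finally show ?thesis .
qed

section \<open>Equal-weight approximation and the quadratic stability estimate\<close>

context compact_kernel
begin

text \<open>Derandomised Monte Carlo: the point minimising the interaction \<open>\<phi>\<close> with the current error has
  \<open>\<phi> \<le> 0\<close>, since \<open>\<phi>\<close> has mean zero, so that the squared norm of the unnormalised error grows linearly.\<close>

lemma greedy_points:
  assumes \<mu>: "\<mu> \<in> prob_measures"
  shows "\<exists>x. (\<Sum>i<N. \<Sum>j<N. K (x i) (x j)) - 2 * real N * (\<Sum>i<N. \<integral>y. K (x i) y \<partial>\<mu>)
    + (real N)\<^sup>2 * kernel_energy K \<mu> \<mu> \<le> 4 * M * real N"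
proof (induction N)
  case (Suc N)
  then obtain x where x: "(\<Sum>i<N. \<Sum>j<N. K (x i) (x j)) - 2 * real N * (\<Sum>i<N. \<integral>y. K (x i) y \<partial>\<mu>)
    + (real N)\<^sup>2 * kernel_energy K \<mu> \<mu> \<le> 4 * M * real N" by blast
  define h where "h z = (\<integral>y. K z y \<partial>\<mu>)" for z
  define E where "E = kernel_energy K \<mu> \<mu>"
  \<comment> \<open>The kernel inner product of the unnormalised error, the sum of the point masses
    at \<open>x i\<close> minus N\<mu>, with the new increment, the point mass at \<open>z\<close>
    minus \<mu>.\<close>
  define \<phi> where "\<phi> z = (\<Sum>i<N. K (x i) z) - real N * h z - (\<Sum>i<N. h (x i)) + real N * E" for z
  have ch: "continuous_on UNIV h" unfolding h_def using potential_continuous[OF \<mu>] .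
  have ih: "integrable \<mu> h" unfolding h_def using potential_integrable[OF \<mu> \<mu>] .
  have "prob_space \<mu>" using prob_measures_D[OF \<mu>] by simp
  then interpret prob_space \<mu> .
  have "(\<integral>z. \<phi> z \<partial>\<mu>) = (\<Sum>i<N. \<integral>z. K (x i) z \<partial>\<mu>) - real N * (\<integral>z. h z \<partial>\<mu>) - (\<Sum>i<N. h (x i)) + real N * E"
    unfolding \<phi>_def using ih kernel_integrable[OF \<mu>] by (simp add: prob_space)
  also have "(\<integral>z. h z \<partial>\<mu>) = E" by (simp add: E_def h_def kernel_energy_def)
  finally have mean: "(\<integral>z. \<phi> z \<partial>\<mu>) = 0" by (simp add: h_def)
  have "continuous_on UNIV \<phi>" unfolding \<phi>_def by (intro continuous_intros cont_right ch)
  then obtain z where z: "\<And>y. \<phi> z \<le> \<phi> y"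
    using continuous_attains_inf[OF compact_UNIV] by blast
  have "integrable \<mu> \<phi>" unfolding \<phi>_def using ih kernel_integrable[OF \<mu>] by simp
  then have "(\<integral>y. \<phi> z \<partial>\<mu>) \<le> (\<integral>y. \<phi> y \<partial>\<mu>)" using z by (intro integral_mono) auto
  then have le0: "\<phi> z \<le> 0" by (simp add: mean prob_space)
  define x' where "x' = x(N := z)"
  have same: "x' i = x i" if "i < N" for i using that by (simp add: x'_def)
  have last: "x' N = z" by (simp add: x'_def)
  have "(\<Sum>j<N. K z (x j)) = (\<Sum>i<N. K (x i) z)" by (intro sum.cong refl kernel_sym)
  then have "(\<Sum>i<Suc N. \<Sum>j<Suc N. K (x' i) (x' j)) =
      (\<Sum>i<N. \<Sum>j<N. K (x i) (x j)) + 2 * (\<Sum>i<N. K (x i) z) + K z z"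
    by (simp add: same last sum.distrib)
  moreover have "(\<Sum>i<Suc N. h (x' i)) = (\<Sum>i<N. h (x i)) + h z" by (simp add: same last)
  moreover have "real (Suc N) = real N + 1" by simp
  \<comment> \<open>Expansion of a squared norm: old error, twice the inner product
    \<open>\<phi> z\<close>, and the squared norm of the increment, which is at most
    \<open>4 * M\<close>.\<close>
  ultimately have "(\<Sum>i<Suc N. \<Sum>j<Suc N. K (x' i) (x' j)) - 2 * real (Suc N) * (\<Sum>i<Suc N. h (x' i))
      + (real (Suc N))\<^sup>2 * E
     = ((\<Sum>i<N. \<Sum>j<N. K (x i) (x j)) - 2 * real N * (\<Sum>i<N. h (x i)) + (real N)\<^sup>2 * E)
      + 2 * \<phi> z + (K z z - 2 * h z + E)"
    unfolding \<phi>_def by (simp only:) (simp add: algebra_simps power2_eq_square)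
  moreover have "K z z - 2 * h z + E \<le> 4 * M"
    using M_bound[of z z] potential_bound[OF \<mu>, of z] energy_bound[OF \<mu> \<mu>] unfolding h_def E_def by linarith
  ultimately have "(\<Sum>i<Suc N. \<Sum>j<Suc N. K (x' i) (x' j)) - 2 * real (Suc N) * (\<Sum>i<Suc N. h (x' i))
      + (real (Suc N))\<^sup>2 * E \<le> 4 * M * real (Suc N)"
    using x le0 unfolding h_def[symmetric] E_def[symmetric] by (simp add: algebra_simps)
  then show ?case unfolding h_def E_def by blast
qed simp

lemma empirical_approximation:
  assumes \<mu>: "\<mu> \<in> prob_measures" and N: "N > 0"
  shows "\<exists>x. dsq \<mu> (empirical_measure N x) \<le> 4 * M / N"
proof -
  obtain x where x: "(\<Sum>i<N. \<Sum>j<N. K (x i) (x j)) - 2 * real N * (\<Sum>i<N. \<integral>y. K (x i) y \<partial>\<mu>)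
    + (real N)\<^sup>2 * kernel_energy K \<mu> \<mu> \<le> 4 * M * real N"
    using greedy_points[OF \<mu>] by blast
  let ?\<nu> = "empirical_measure N x"
  have \<nu>: "?\<nu> \<in> prob_measures" by (rule empirical_measure_prob)
  have "kernel_energy K \<mu> ?\<nu> = (\<Sum>i<N. \<integral>y. K (x i) y \<partial>\<mu>) / N"
    unfolding energy_sym[OF \<mu> \<nu>] unfolding kernel_energy_def
    by (rule integral_empirical_measure[OF N potential_continuous[OF \<mu>]])
  moreover have "kernel_energy K ?\<nu> ?\<nu> = (\<Sum>i<N. \<Sum>j<N. K (x i) (x j)) / (real N)\<^sup>2"
  proof -
    have "kernel_energy K ?\<nu> ?\<nu> = (\<Sum>i<N. \<integral>y. K (x i) y \<partial>?\<nu>) / N"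
      unfolding kernel_energy_def by (rule integral_empirical_measure[OF N potential_continuous[OF \<nu>]])
    then show ?thesis
      by (simp add: integral_empirical_measure[OF N cont_right] power2_eq_square sum_divide_distrib)
  qed
  ultimately have "(real N)\<^sup>2 * dsq \<mu> ?\<nu> = (\<Sum>i<N. \<Sum>j<N. K (x i) (x j)) - 2 * real N * (\<Sum>i<N. \<integral>y. K (x i) y \<partial>\<mu>)
    + (real N)\<^sup>2 * kernel_energy K \<mu> \<mu>"
    using N by (simp add: dsq_def field_simps power2_eq_square)
  then have "real N * (real N * dsq \<mu> ?\<nu>) \<le> real N * (4 * M)"
    using x by (simp add: power2_eq_square mult.commute mult.left_commute)
  then have "dsq \<mu> ?\<nu> \<le> 4 * M / N" using N by (simp add: field_simps)
  then show ?thesis by blast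
qed

text \<open>The hypothesis is used twice: on the kernel sections it gives
  \<open>\<theta> * M\<close> as a bound for the potential difference \<open>g\<close>, and on
  \<open>g\<close> itself it gives the second factor \<open>\<theta>\<close>, because integrating
  \<open>g\<close> against the difference of the measures yields \<open>dsq\<close>.\<close>

lemma dsq_le_of_weak_bound:
  assumes \<nu>: "\<nu> \<in> prob_measures" "\<eta> \<in> prob_measures"
    and weak: "\<And>f B. continuous_on UNIV f \<Longrightarrow> (\<And>x. \<bar>f x\<bar> \<le> B) \<Longrightarrow>
      \<bar>(\<integral>x. f x \<partial>\<nu>) - (\<integral>x. f x \<partial>\<eta>)\<bar> \<le> \<theta> * B"
  shows "dsq \<nu> \<eta> \<le> \<theta>\<^sup>2 * M"
proof -
  define g where "g x = (\<integral>y. K x y \<partial>\<nu>) - (\<integral>y. K x y \<partial>\<eta>)" for x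
  have cg: "continuous_on UNIV g" unfolding g_def by (intro continuous_intros potential_continuous \<nu>)
  have "\<bar>g x\<bar> \<le> \<theta> * M" for x unfolding g_def using weak[OF cont_right M_bound] .
  then have "\<bar>(\<integral>x. g x \<partial>\<nu>) - (\<integral>x. g x \<partial>\<eta>)\<bar> \<le> \<theta> * (\<theta> * M)" using weak[OF cg] by blast
  moreover have "(\<integral>x. g x \<partial>\<nu>) - (\<integral>x. g x \<partial>\<eta>) = dsq \<nu> \<eta>"
    unfolding g_def using potential_integrable \<nu> energy_sym[OF \<nu>]
    by (simp add: dsq_def kernel_energy_def)
  ultimately show ?thesis by (simp add: power2_eq_square mult.assoc)
qed

end

subsection \<open>Closed walks with dwelling times\<close>

text \<open>Kept general in \<open>g\<close>: with \<open>g u v\<close> the integral of a test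
  function along the geodesic from \<open>u\<close> to \<open>v\<close>, this is the integral
  against the curve measure times the number of moves.\<close>

fun walk_sum :: "('a \<Rightarrow> 'a \<Rightarrow> real) \<Rightarrow> 'a list \<Rightarrow> real" where
  "walk_sum g (u # v # ws) = g u v + walk_sum g (v # ws)"
| "walk_sum g _ = 0"

lemma walk_sum_append: "walk_sum g (p @ v # q) = walk_sum g (p @ [v]) + walk_sum g (v # q)"
  by (induction g p rule: walk_sum.induct) (auto simp: neq_Nil_conv split: list.splits)

lemma walk_sum_bound:
  assumes "\<And>u v. \<bar>g u v\<bar> \<le> B"
  shows "\<bar>walk_sum g ws\<bar> \<le> B * length ws"
proof -
  have "B \<ge> 0" using assms[of undefined undefined] by linarith
  with assms show ?thesis
  proof (induction g ws rule: walk_sum.induct)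
    case (1 g u v ws)
    then have "\<bar>walk_sum g (v # ws)\<bar> \<le> B * length (v # ws)" "\<bar>g u v\<bar> \<le> B" by blast+
    then show ?case by (simp add: distrib_left)
  qed auto
qed

lemma walk_sum_nth: "walk_sum g ws = (\<Sum>j<length ws - 1. g (ws ! j) (ws ! Suc j))"
proof (induction g ws rule: walk_sum.induct)
  case (1 g u v ws)
  then show ?case by (simp add: sum.lessThan_Suc_shift del: sum.lessThan_Suc)
qed auto

lemma walk_sum_replicate:
  "walk_sum g (replicate (Suc k) x @ v # q) = real k * g x x + g x v + walk_sum g (v # q)"
  by (induction k) (auto simp: distrib_right)

lemma walk_insert_detour:
  fixes ws :: "'a::metric_space list"
  assumes "v \<in> set ws" "hd ws = last ws" "successively (\<lambda>u v. dist u v \<le> \<rho>) ws" "dist v x \<le> \<rho>" "\<rho> \<ge> 0"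
  shows "\<exists>ws'. set ws' = insert x (set ws) \<and> hd ws' = last ws' \<and>
    successively (\<lambda>u v. dist u v \<le> \<rho>) ws' \<and> length ws' = length ws + k + 2 \<and>
    (\<forall>g. walk_sum g ws' = walk_sum g ws + real k * g x x + g v x + g x v)"
proof -
  obtain p q where ws: "ws = p @ v # q" using split_list[OF assms(1)] by blast
  \<comment> \<open>One visit to \<open>v\<close> becomes an excursion to \<open>x\<close> and back.
    The \<open>Suc k\<close> copies of \<open>x\<close> account for \<open>k\<close> resting moves;
    starting and ending the excursion at \<open>v\<close> keeps the walk closed.\<close>
  define ws' where "ws' = p @ v # replicate (Suc k) x @ v # q"
  have "walk_sum g ws' = walk_sum g ws + real k * g x x + g v x + g x v" for g
  proof -
    have "walk_sum g (v # replicate (Suc k) x @ v # q) = g v x + walk_sum g (replicate (Suc k) x @ v # q)"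
      by simp
    then show ?thesis
      using walk_sum_append[of g p v q] walk_sum_append[of g p v "replicate (Suc k) x @ v # q"]
        walk_sum_replicate[of g k x v q] by (simp add: ws'_def ws)
  qed
  moreover have "hd ws' = last ws'" using assms(2) by (cases p) (auto simp: ws'_def ws)
  moreover have "successively (\<lambda>u v. dist u v \<le> \<rho>) (replicate n x)" for n
    using assms(5) by (simp add: successively_conv_nth)
  from this[of "Suc k"] have "successively (\<lambda>u v. dist u v \<le> \<rho>) ws'"
    using assms(3,4) by (simp add: ws'_def ws successively_append_iff successively_Cons dist_commute
        del: replicate_Suc)
  ultimately show ?thesis
    by (intro exI[of _ ws']) (auto simp: ws'_def ws)
qed

text \<open>The walk goes around a spanning tree: the cut condition \<open>conn\<close> always
  yields an unvisited point near a visited one, and attaching it by an excursion without rest costs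
  two moves.\<close>

lemma closed_walk_through_connected_set:
  fixes Y :: "'a::metric_space set"
  assumes Y: "finite Y" "Y \<noteq> {}" and \<rho>: "\<rho> \<ge> 0"
    and conn: "\<forall>V. V \<noteq> {} \<longrightarrow> V \<subset> Y \<longrightarrow> (\<exists>v\<in>V. \<exists>y\<in>Y - V. dist v y \<le> \<rho>)"
  shows "\<exists>ws. set ws = Y \<and> hd ws = last ws \<and> successively (\<lambda>u v. dist u v \<le> \<rho>) ws \<and>
    length ws + 1 = 2 * card Y"
proof -
  have "\<exists>ws. set ws \<subseteq> Y \<and> card (set ws) = Suc n \<and> hd ws = last ws \<and>
    successively (\<lambda>u v. dist u v \<le> \<rho>) ws \<and> length ws + 1 = 2 * Suc n" if "Suc n \<le> card Y" for n
    using that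
  proof (induction n)
    case 0
    obtain y where "y \<in> Y" using Y by blast
    then show ?case by (intro exI[of _ "[y]"]) auto
  next
    case (Suc n)
    then obtain ws where ws: "set ws \<subseteq> Y" "card (set ws) = Suc n" "hd ws = last ws"
      "successively (\<lambda>u v. dist u v \<le> \<rho>) ws" "length ws + 1 = 2 * Suc n" by auto
    have "set ws \<noteq> {}" "set ws \<subset> Y" using ws(1,2) Suc.prems by auto
    then obtain v y where vy: "v \<in> set ws" "y \<in> Y - set ws" "dist v y \<le> \<rho>" using conn by blast
    obtain ws' where "set ws' = insert y (set ws)" "hd ws' = last ws'"
      "successively (\<lambda>u v. dist u v \<le> \<rho>) ws'" "length ws' = length ws + 2"
      using walk_insert_detour[OF vy(1) ws(3,4) vy(3) \<rho>, of 0] by auto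
    then show ?case using ws vy by (intro exI[of _ ws']) auto
  qed
  from this[of "card Y - 1"] obtain ws where "set ws \<subseteq> Y" "card (set ws) = card Y" "hd ws = last ws"
    "successively (\<lambda>u v. dist u v \<le> \<rho>) ws" "length ws + 1 = 2 * card Y"
    using Y by (auto simp: card_gt_0_iff Suc_diff_Suc)
  then show ?thesis using card_subset_eq[OF Y(1)] by blast
qed

text \<open>Each point \<open>x i\<close> hangs on a nearby net point by its own excursion, so the
  points may repeat or lie far from one another. Only the tree moves and the two travelling moves
  per excursion contribute to the error, independently of \<open>k\<close>.\<close>

lemma closed_walk_with_dwelling:
  fixes Y :: "'a::metric_space set" and x :: "nat \<Rightarrow> 'a"
  assumes Y: "finite Y" "Y \<noteq> {}" and \<rho>: "\<rho> \<ge> 0"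
    and conn: "\<forall>V. V \<noteq> {} \<longrightarrow> V \<subset> Y \<longrightarrow> (\<exists>v\<in>V. \<exists>y\<in>Y - V. dist v y \<le> \<rho>)"
    and near: "\<forall>i. \<exists>y\<in>Y. dist y (x i) \<le> \<rho>"
  shows "\<exists>ws. hd ws = last ws \<and> successively (\<lambda>u v. dist u v \<le> \<rho>) ws \<and>
    length ws + 1 = 2 * card Y + N * (k + 2) \<and>
    (\<forall>g B. (\<forall>u v. \<bar>g u v\<bar> \<le> B) \<longrightarrow>
      \<bar>walk_sum g ws - real k * (\<Sum>i<N. g (x i) (x i))\<bar> \<le> B * (2 * card Y + 2 * N))"
proof -
  have "\<exists>ws. Y \<subseteq> set ws \<and> hd ws = last ws \<and> successively (\<lambda>u v. dist u v \<le> \<rho>) ws \<and>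
    length ws + 1 = 2 * card Y + N * (k + 2) \<and>
    (\<forall>g B. (\<forall>u v. \<bar>g u v\<bar> \<le> B) \<longrightarrow>
      \<bar>walk_sum g ws - real k * (\<Sum>i<N. g (x i) (x i))\<bar> \<le> B * (2 * card Y + 2 * N))"
  proof (induction N)
    case 0
    obtain ws where ws: "set ws = Y" "hd ws = last ws"
      "successively (\<lambda>u v. dist u v \<le> \<rho>) ws" "length ws + 1 = 2 * card Y"
      using closed_walk_through_connected_set[OF Y \<rho> conn] by blast
    have "\<bar>walk_sum g ws\<bar> \<le> B * (2 * card Y)" if g: "\<forall>u v. \<bar>g u v\<bar> \<le> B" for g B
    proof -
      have "B \<ge> 0" using g[rule_format, of undefined undefined] by linarith
      moreover have "real (length ws) \<le> 2 * card Y" using ws(4) by linarith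
      ultimately show ?thesis
        using walk_sum_bound[of g B ws] g mult_left_mono[of "real (length ws)" "2 * card Y" B] by simp
    qed
    then show ?case using ws by auto
  next
    case (Suc N)
    then obtain ws where ws: "Y \<subseteq> set ws" "hd ws = last ws" "successively (\<lambda>u v. dist u v \<le> \<rho>) ws"
      "length ws + 1 = 2 * card Y + N * (k + 2)"
      "\<And>g B. (\<forall>u v. \<bar>g u v\<bar> \<le> B) \<Longrightarrow>
        \<bar>walk_sum g ws - real k * (\<Sum>i<N. g (x i) (x i))\<bar> \<le> B * (2 * card Y + 2 * N)" by auto
    obtain y where y: "y \<in> Y" "dist y (x N) \<le> \<rho>" using near by blast
    then have "y \<in> set ws" using ws(1) by blast
    from walk_insert_detour[OF this ws(2,3) y(2) \<rho>, of k] obtain ws' where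
      ws': "set ws' = insert (x N) (set ws)" "hd ws' = last ws'"
      "successively (\<lambda>u v. dist u v \<le> \<rho>) ws'" "length ws' = length ws + k + 2"
      "\<And>g. walk_sum g ws' = walk_sum g ws + real k * g (x N) (x N) + g y (x N) + g (x N) y" by auto
    have "\<bar>walk_sum g ws' - real k * (\<Sum>i<Suc N. g (x i) (x i))\<bar> \<le> B * (2 * card Y + 2 * Suc N)"
      if g: "\<forall>u v. \<bar>g u v\<bar> \<le> B" for g B
    proof -
      have "\<bar>g y (x N)\<bar> \<le> B" "\<bar>g (x N) y\<bar> \<le> B" using g by auto
      moreover have "walk_sum g ws' - real k * (\<Sum>i<Suc N. g (x i) (x i)) =
          (walk_sum g ws - real k * (\<Sum>i<N. g (x i) (x i))) + g y (x N) + g (x N) y"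
        by (simp add: ws'(5) algebra_simps)
      moreover have "B * (2 * card Y + 2 * Suc N) = B * (2 * card Y + 2 * N) + 2 * B"
        by (simp add: algebra_simps)
      ultimately show ?thesis using ws(5)[OF g] by linarith
    qed
    moreover have "length ws' + 1 = 2 * card Y + Suc N * (k + 2)" using ws(4) ws'(4) by simp
    ultimately show ?case using ws(1) ws' by (intro exI[of _ ws']) blast
  qed
  then show ?thesis by blast
qed

section \<open>Curves running along closed walks\<close>

lemma integral_curve_measure_const:
  fixes f :: "'a::metric_space \<Rightarrow> real"
  assumes "continuous_on {0..1} \<gamma>" "continuous_on UNIV f"
  shows "(\<integral>x. f x \<partial>curve_measure \<gamma> (\<lambda>_. 1)) = integral {0..1} (\<lambda>t. f (\<gamma> t))"
proof -
  have c: "continuous_on {0..1} (\<lambda>t. f (\<gamma> t))"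
    using continuous_on_compose2[OF assms(2,1)] by auto
  have "(\<integral>x. f x \<partial>curve_measure \<gamma> (\<lambda>_. 1)) = (\<integral>t. 1 * f (\<gamma> t) \<partial>lebesgue01)"
    using assms by (intro integral_curve_measure) auto
  also have "\<dots> = (LINT t:{0..1}|lborel. f (\<gamma> t))"
    unfolding lebesgue01_def set_lebesgue_integral_def by (subst integral_restrict_space) auto
  also have "\<dots> = integral {0..1} (\<lambda>t. f (\<gamma> t))"
    using set_borel_integral_eq_integral(2)[OF borel_integrable_atLeastAtMost'[OF c]] .
  finally show ?thesis .
qed

text \<open>Every move gets the same time \<open>1 / m\<close>, so a geodesic of length at most
  \<open>\<rho>\<close> is traversed at speed at most \<open>\<rho> * m\<close>, and the integral is
  the plain average of the move integrals.\<close>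

lemma curve_along_closed_walk:
  fixes ws :: "'a::metric_space list" and G :: "'a \<Rightarrow> 'a \<Rightarrow> real \<Rightarrow> 'a"
  assumes G: "\<And>u v. (dist u v)-lipschitz_on {0..1} (G u v)" "\<And>u v. G u v 0 = u" "\<And>u v. G u v 1 = v"
    and ws: "hd ws = last ws" "successively (\<lambda>u v. dist u v \<le> \<rho>) ws" "length ws = Suc m" "m > 0"
  shows "\<exists>\<gamma>\<in>closed_lip_curves (\<rho> * m). \<forall>f :: 'a \<Rightarrow> real. continuous_on UNIV f \<longrightarrow>
    (\<integral>x. f x \<partial>curve_measure \<gamma> (\<lambda>_. 1)) = walk_sum (\<lambda>u v. integral {0..1} (\<lambda>t. f (G u v t))) ws / m"
proof -
  define w where "w j = ws ! j" for j
  have step: "dist (w j) (w (Suc j)) \<le> \<rho>" if "j < m" for j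
    using ws(2,3) that unfolding w_def by (auto simp: successively_conv_nth)
  have \<rho>: "\<rho> \<ge> 0" using step[OF ws(4)] zero_le_dist order_trans by blast
  \<comment> \<open>At \<open>s = m\<close> the value \<open>w (Suc m)\<close> lies beyond the end
    of the list; this is harmless, since the geodesic is then evaluated at parameter 0, where it
    equals \<open>w m\<close>.\<close>
  define \<Gamma> where "\<Gamma> s = G (w (nat \<lfloor>s\<rfloor>)) (w (Suc (nat \<lfloor>s\<rfloor>))) (s - real (nat \<lfloor>s\<rfloor>))" for s
  have \<Gamma>_nat: "\<Gamma> (real j) = w j" for j by (simp add: \<Gamma>_def G)
  have \<Gamma>: "\<Gamma> s = G (w j) (w (Suc j)) (s - real j)" if "s \<in> {real j..real j + 1}" for s j
  proof (cases "s = real j + 1")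
    case True
    then show ?thesis using \<Gamma>_nat[of "Suc j"] by (simp add: G add.commute)
  next
    case False
    then have "\<lfloor>s\<rfloor> = int j" using that by (simp add: floor_eq_iff)
    then show ?thesis by (simp add: \<Gamma>_def)
  qed
  have piece: "\<rho>-lipschitz_on {real j..real j + 1} \<Gamma>" if "j < m" for j
  proof (rule lipschitz_onI)
    fix s t assume st: "s \<in> {real j..real j + 1}" "t \<in> {real j..real j + 1}"
    have "dist (\<Gamma> s) (\<Gamma> t) \<le> dist (w j) (w (Suc j)) * dist (s - real j) (t - real j)"
      unfolding \<Gamma>[OF st(1)] \<Gamma>[OF st(2)] using st by (intro lipschitz_onD[OF G(1)]) auto
    also have "\<dots> \<le> \<rho> * dist s t" using step[OF that] by (intro mult_mono) (auto simp: dist_real_def \<rho>)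
    finally show "dist (\<Gamma> s) (\<Gamma> t) \<le> \<rho> * dist s t" .
  qed (rule \<rho>)
  have lip: "\<rho>-lipschitz_on {0..real n} \<Gamma>" if "n \<le> m" for n
    using that
  proof (induction n)
    case 0
    then show ?case using \<rho> by (auto intro: lipschitz_onI)
  next
    case (Suc n)
    have "\<rho>-lipschitz_on {0..real n + 1} (\<lambda>x. if x \<le> real n then \<Gamma> x else \<Gamma> x)"
      using Suc by (intro lipschitz_on_concat piece) auto
    then show ?case by (simp add: add.commute)
  qed
  have int: "((\<lambda>s. f (\<Gamma> s)) has_integral (\<Sum>j<n. integral {0..1} (\<lambda>t. f (G (w j) (w (Suc j)) t)))) {0..real n}"
    if f: "continuous_on UNIV f" for f :: "'a \<Rightarrow> real" and n
  proof (induction n)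
    case (Suc n)
    let ?h = "\<lambda>t. f (G (w n) (w (Suc n)) t)"
    have "continuous_on {0..1} ?h"
      using continuous_on_compose2[OF f lipschitz_on_continuous_on[OF G(1)]] by auto
    then have "(?h has_integral integral {0..1} ?h) {0..1}"
      by (intro integrable_integral integrable_continuous_real)
    moreover have "((\<lambda>s. f (\<Gamma> s)) \<circ> ((+) (real n)) has_integral I) {0..1} \<longleftrightarrow> (?h has_integral I) {0..1}" for I
      by (intro has_integral_cong) (use \<Gamma>[of _ n] in auto)
    ultimately have "((\<lambda>s. f (\<Gamma> s)) has_integral integral {0..1} ?h) {real n..real n + 1}"
      using has_integral_shift_Icc_real[of "\<lambda>s. f (\<Gamma> s)" "real n" "integral {0..1} ?h" 0 1]
      by (simp add: add.commute)
    then show ?case using has_integral_combine[OF _ _ Suc.IH] by (simp add: add.commute)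
  qed (simp add: has_integral_refl)
  define \<gamma> where "\<gamma> t = \<Gamma> (real m * t)" for t
  have "(\<rho> * m)-lipschitz_on {0..1} \<gamma>"
  proof (rule lipschitz_onI)
    fix s t :: real assume st: "s \<in> {0..1}" "t \<in> {0..1}"
    have "dist (\<gamma> s) (\<gamma> t) \<le> \<rho> * dist (real m * s) (real m * t)"
      unfolding \<gamma>_def using st by (intro lipschitz_onD[OF lip[OF order_refl]]) (auto simp: mult_left_le)
    also have "\<dots> = \<rho> * m * dist s t" by (simp add: dist_real_def abs_mult flip: right_diff_distrib)
    finally show "dist (\<gamma> s) (\<gamma> t) \<le> \<rho> * m * dist s t" .
  qed (use \<rho> in simp)
  moreover have "\<gamma> 0 = \<gamma> 1"
    using ws \<Gamma>_nat[of 0] \<Gamma>_nat[of m] by (cases ws) (auto simp: \<gamma>_def w_def last_conv_nth)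
  ultimately have \<gamma>: "\<gamma> \<in> closed_lip_curves (\<rho> * m)" by (simp add: closed_lip_curves_def)
  have "(\<integral>x. f x \<partial>curve_measure \<gamma> (\<lambda>_. 1)) = walk_sum (\<lambda>u v. integral {0..1} (\<lambda>t. f (G u v t))) ws / m"
    if f: "continuous_on UNIV f" for f :: "'a \<Rightarrow> real"
  proof -
    have img: "(\<lambda>x. x / real m) ` {0..real m} = {0..1}"
      using ws(4) by (auto simp: image_iff divide_simps intro!: bexI[of _ "_ * real m"])
    have "((\<lambda>t. f (\<gamma> t)) has_integral walk_sum (\<lambda>u v. integral {0..1} (\<lambda>t. f (G u v t))) ws / m) {0..1}"
      using has_integral_stretch_real[OF int[OF f, of m], of "real m"] ws(3,4)
      unfolding img \<gamma>_def by (simp add: walk_sum_nth w_def)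
    then show ?thesis
      using integral_curve_measure_const[OF closed_lip_curves_continuous[OF \<gamma>] f] by (simp add: integral_unique)
  qed
  then show ?thesis using \<gamma> by blast
qed

text \<open>Both \<open>m\<close> times the empirical mean and the walk sum differ from
  \<open>k\<close> times the sum of the values by at most \<open>(2 * card Y + 2 * N) * B\<close>.
  Adding the two errors and dividing by \<open>m\<close> gives the constant 4.\<close>

lemma empirical_approx_along_curve:
  fixes Y :: "'a::metric_space set" and x :: "nat \<Rightarrow> 'a" and G :: "'a \<Rightarrow> 'a \<Rightarrow> real \<Rightarrow> 'a"
  assumes G: "\<And>u v. (dist u v)-lipschitz_on {0..1} (G u v)" "\<And>u v. G u v 0 = u" "\<And>u v. G u v 1 = v"
    and Y: "finite Y" "Y \<noteq> {}" and \<rho>: "\<rho> \<ge> 0" and N: "N > 0"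
    and conn: "\<forall>V. V \<noteq> {} \<longrightarrow> V \<subset> Y \<longrightarrow> (\<exists>v\<in>V. \<exists>y\<in>Y - V. dist v y \<le> \<rho>)"
    and near: "\<forall>i. \<exists>y\<in>Y. dist y (x i) \<le> \<rho>"
    and m: "m + 2 = 2 * card Y + N * (k + 2)"
  shows "\<exists>\<gamma>\<in>closed_lip_curves (\<rho> * m). \<forall>f B. continuous_on UNIV f \<longrightarrow> (\<forall>x. \<bar>f x\<bar> \<le> B) \<longrightarrow>
    \<bar>(\<Sum>i<N. f (x i)) / N - (\<integral>x. f x \<partial>curve_measure \<gamma> (\<lambda>_. 1))\<bar> \<le> (4 * (card Y + N) / m) * B"
proof -
  obtain ws where ws: "hd ws = last ws" "successively (\<lambda>u v. dist u v \<le> \<rho>) ws"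
    "length ws + 1 = 2 * card Y + N * (k + 2)"
    "\<And>g B. (\<forall>u v. \<bar>g u v\<bar> \<le> B) \<Longrightarrow>
      \<bar>walk_sum g ws - real k * (\<Sum>i<N. g (x i) (x i))\<bar> \<le> B * (2 * card Y + 2 * N)"
    using closed_walk_with_dwelling[OF Y \<rho> conn near, of N k] by blast
  have card: "card Y \<ge> 1" using Y by (simp add: Suc_leI card_gt_0_iff)
  have "N * 2 \<le> N * (k + 2)" by simp
  then have m0: "m > 0" using m card N by linarith
  have len: "length ws = Suc m" using ws(3) m by simp
  obtain \<gamma> where \<gamma>: "\<gamma> \<in> closed_lip_curves (\<rho> * m)"
    "\<And>f :: 'a \<Rightarrow> real. continuous_on UNIV f \<Longrightarrow>
    (\<integral>x. f x \<partial>curve_measure \<gamma> (\<lambda>_. 1)) = walk_sum (\<lambda>u v. integral {0..1} (\<lambda>t. f (G u v t))) ws / m"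
    using curve_along_closed_walk[OF G ws(1,2) len m0] by blast
  have "\<bar>(\<Sum>i<N. f (x i)) / N - (\<integral>x. f x \<partial>curve_measure \<gamma> (\<lambda>_. 1))\<bar> \<le> (4 * (card Y + N) / m) * B"
    if f: "continuous_on UNIV f" "\<And>x. \<bar>f x\<bar> \<le> B" for f B
  proof -
    define g where "g u v = integral {0..1} (\<lambda>t. f (G u v t))" for u v
    define S where "S = (\<Sum>i<N. f (x i))"
    have B: "B \<ge> 0" using f(2)[of undefined] by linarith
    have "\<bar>g u v\<bar> \<le> B" for u v
    proof -
      have "continuous_on {0..1} (\<lambda>t. f (G u v t))"
        using continuous_on_compose2[OF f(1) lipschitz_on_continuous_on[OF G(1)]] by auto
      then have "norm (integral {0..1} (\<lambda>t. f (G u v t))) \<le> B * (1 - 0)"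
        using f(2) by (intro integral_bound) auto
      then show ?thesis by (simp add: g_def)
    qed
    then have "\<bar>walk_sum g ws - real k * (\<Sum>i<N. g (x i) (x i))\<bar> \<le> B * (2 * card Y + 2 * N)"
      by (intro ws(4)) blast
    moreover have "g u u = f u" for u
    proof -
      \<comment> \<open>A geodesic from a point to itself has Lipschitz constant 0, so a resting
        move contributes exactly \<open>f u\<close>.\<close>
      have "G u u t = u" if "t \<in> {0..1}" for t
        using lipschitz_onD[OF G(1)[of u u] that, of 0] G(2)[of u u] by simp
      then have "integral {0..1} (\<lambda>t. f (G u u t)) = integral {0..1} (\<lambda>t :: real. f u)"
        by (metis (mono_tags, lifting) Henstock_Kurzweil_Integration.integral_cong)
      then show ?thesis by (simp add: g_def)
    qed
    ultimately have 1: "\<bar>walk_sum g ws - real k * S\<bar> \<le> B * (2 * card Y + 2 * N)" by (simp add: S_def)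
    have "\<bar>S\<bar> \<le> (\<Sum>i<N. \<bar>f (x i)\<bar>)" unfolding S_def by (rule sum_abs)
    also have "\<dots> \<le> (\<Sum>i<N. B)" by (intro sum_mono f(2))
    finally have S: "\<bar>S\<bar> \<le> real N * B" by simp
    have "real (m + 2) = real (2 * card Y + N * (k + 2))" by (simp only: m)
    then have mk: "real m = real N * real k + (2 * real (card Y) + 2 * real N - 2)" by (simp add: algebra_simps)
    let ?E = "(2 * real (card Y) + 2 * real N) * B" and ?q = "(2 * real (card Y) + 2 * real N - 2) * (S / N)"
    \<comment> \<open>Of the \<open>m\<close> moves, \<open>N * k\<close> are rests spread evenly
      over the points; the others number \<open>2 * card Y + 2 * N - 2\<close>, and their share of
      the mean is the error \<open>?q\<close>.\<close>
    have "real m * (S / N) = real N * real k * (S / N) + ?q" by (simp only: mk distrib_right)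
    moreover have "real N * real k * (S / N) = real k * S" using N by simp
    ultimately have eq: "real m * (S / N) = real k * S + ?q" by simp
    have q: "\<bar>?q\<bar> \<le> ?E"
    proof -
      have "\<bar>S / N\<bar> \<le> B" using S N by (simp add: field_simps)
      then show ?thesis unfolding abs_mult using card B by (intro mult_mono) auto
    qed
    have tri: "\<bar>a - W\<bar> \<le> 2 * E" if "a = p + q" "\<bar>q\<bar> \<le> E" "\<bar>W - p\<bar> \<le> E" for a p q W E :: real
      using that by linarith
    have "\<bar>walk_sum g ws - real k * S\<bar> \<le> ?E" using 1 by (simp add: mult.commute)
    from tri[OF eq q this] have "\<bar>real m * (S / N) - walk_sum g ws\<bar> \<le> real (4 * (card Y + N)) * B"
      by (simp add: algebra_simps)
    then have "\<bar>m * (S / N) - walk_sum g ws\<bar> / m \<le> 4 * (card Y + N) * B / m"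
      by (intro divide_right_mono) auto
    moreover have "\<bar>real m * a - W\<bar> / m = \<bar>a - W / m\<bar>" for a W :: real
    proof -
      have "(real m * a - W) / m = a - W / m" using m0 by (simp add: diff_divide_distrib)
      then show ?thesis by (metis abs_divide abs_of_nat)
    qed
    ultimately have "\<bar>S / N - walk_sum g ws / m\<bar> \<le> 4 * (card Y + N) * B / m"
      by (simp only:)
    moreover have "(\<lambda>u v. integral {0..1} (\<lambda>t. f (G u v t))) = g" by (simp add: g_def fun_eq_iff)
    ultimately show ?thesis
      using \<gamma>(2)[OF f(1)] unfolding S_def by (simp only: times_divide_eq_left)
  qed
  then show ?thesis using \<gamma>(1) by blast
qed

subsection \<open>Ahlfors regularity and the approximation rate\<close>

text \<open>Packing: closed balls of radius \<open>s\<close> around the points are disjoint, for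
  which the separation has to exceed \<open>2 * s\<close> strictly.\<close>

lemma separated_card_bound:
  fixes \<sigma> :: "'a::metric_space measure" and Y :: "'a set"
  assumes "finite_measure \<sigma>" "sets \<sigma> = sets borel"
    and lower: "\<And>x. b \<le> measure \<sigma> (cball x s)"
    and Y: "finite Y" "\<forall>x\<in>Y. \<forall>y\<in>Y. x \<noteq> y \<longrightarrow> dist x y > 2 * s"
  shows "real (card Y) * b \<le> measure \<sigma> (space \<sigma>)"
proof -
  interpret finite_measure \<sigma> by fact
  have sets: "cball x s \<in> sets \<sigma>" for x using assms(2) by simp
  have disj: "disjoint_family_on (\<lambda>x. cball x s) Y"
    unfolding disjoint_family_on_def
  proof (intro ballI impI)
    fix x y assume xy: "x \<in> Y" "y \<in> Y" "x \<noteq> y"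
    have False if "dist x z \<le> s" "dist y z \<le> s" for z
      using dist_triangle2[of x y z] that Y(2) xy by (smt (verit, best))
    then show "cball x s \<inter> cball y s = {}" by auto
  qed
  have "real (card Y) * b = (\<Sum>x\<in>Y. b)" by simp
  also have "\<dots> \<le> (\<Sum>x\<in>Y. measure \<sigma> (cball x s))" by (intro sum_mono lower)
  also have "\<dots> = measure \<sigma> (\<Union>x\<in>Y. cball x s)"
    by (rule finite_measure_finite_Union[OF Y(1) _ disj, symmetric]) (use sets in auto)
  also have "\<dots> \<le> measure \<sigma> (space \<sigma>)" by (rule bounded_measure)
  finally show ?thesis .
qed

text \<open>The bound lets a separated set of largest cardinality be chosen; a point at distance at
  least \<open>r\<close> from all of it could be added.\<close>

lemma maximal_separated_net:
  fixes r :: real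
  assumes r: "r > 0"
    and bound: "\<And>Y :: 'a::metric_space set. finite Y \<Longrightarrow>
      \<forall>x\<in>Y. \<forall>y\<in>Y. x \<noteq> y \<longrightarrow> dist x y \<ge> r \<Longrightarrow> real (card Y) \<le> b"
  shows "\<exists>Y :: 'a set. finite Y \<and> (\<forall>x. \<exists>y\<in>Y. dist y x < r) \<and> real (card Y) \<le> b"
proof -
  define P where "P Y \<longleftrightarrow> finite Y \<and> (\<forall>x\<in>Y. \<forall>y\<in>Y. x \<noteq> y \<longrightarrow> dist x y \<ge> r)" for Y :: "'a set"
  have "P {}" by (simp add: P_def)
  moreover have "\<forall>Y. P Y \<longrightarrow> card Y < Suc (nat \<lfloor>b\<rfloor>)" using bound by (auto simp: P_def less_Suc_eq_le le_nat_floor)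
  ultimately obtain Y where Y: "P Y" "\<And>Z. P Z \<Longrightarrow> card Z \<le> card Y"
    using ex_has_greatest_nat[of P "{}" card] by blast
  have "\<exists>y\<in>Y. dist y x < r" for x
  proof (rule ccontr)
    assume no: "\<not> ?thesis"
    then have "x \<notin> Y" using r by force
    have "P (insert x Y)" using Y(1) no unfolding P_def by (auto simp: dist_commute not_less)
    then have "card (insert x Y) \<le> card Y" by (rule Y(2))
    then show False using \<open>x \<notin> Y\<close> Y(1) by (simp add: P_def)
  qed
  then show ?thesis using Y(1) bound unfolding P_def by blast
qed

text \<open>The closed balls of radius \<open>r\<close> around \<open>V\<close> and around
  \<open>Y - V\<close> form two nonempty closed sets covering a connected space, so they
  meet.\<close>

lemma net_proximity_connected:
  fixes Y :: "'a::metric_space set"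
  assumes conn: "connected (UNIV :: 'a set)" and Y: "finite Y" "\<forall>x. \<exists>y\<in>Y. dist y x < r"
    and V: "V \<noteq> {}" "V \<subset> Y"
  shows "\<exists>v\<in>V. \<exists>y\<in>Y - V. dist v y \<le> 2 * r"
proof -
  define A where "A = (\<Union>v\<in>V. cball v r)"
  define B where "B = (\<Union>v\<in>Y - V. cball v r)"
  have r: "r > 0"
    using Y(2) zero_le_dist order_le_less_trans by metis
  have fin: "finite V" using V Y(1) finite_subset by blast
  have "closed A" "closed B" unfolding A_def B_def using fin Y(1) by (auto intro!: closed_UN)
  moreover have "A \<union> B = UNIV"
  proof -
    have "x \<in> A \<union> B" for x
    proof -
      obtain y where "y \<in> Y" "dist y x < r" using Y(2) by blast
      then show ?thesis by (cases "y \<in> V") (force simp: A_def B_def)+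
    qed
    then show ?thesis by blast
  qed
  moreover have "V \<subseteq> A" "Y - V \<subseteq> B" using r by (auto simp: A_def B_def)
  then have "A \<noteq> {}" "B \<noteq> {}" using V by blast+
  ultimately have "A \<inter> B \<noteq> {}" using connected_closedD[OF conn, of A B] by auto
  then obtain z v y where vy: "v \<in> V" "y \<in> Y - V" "dist v z \<le> r" "dist y z \<le> r"
    unfolding A_def B_def by (fastforce simp del: Diff_iff)
  then have "dist v y \<le> 2 * r" using dist_triangle2[of v y z] by simp
  then show ?thesis using vy by blast
qed

lemma compact_length_space_connected:
  assumes "compact (UNIV :: 'a::metric_space set)" "length_space TYPE('a)"
  shows "connected (UNIV :: 'a set)"
proof -
  have "\<exists>g. path g \<and> path_image g \<subseteq> UNIV \<and> pathstart g = x \<and> pathfinish g = y" for x y :: 'a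
    using compact_length_space_geodesic[OF assms, of x y] lipschitz_on_continuous_on
    unfolding path_def pathstart_def pathfinish_def by blast
  then have "path_connected (UNIV :: 'a set)" unfolding path_connected_def by blast
  then show ?thesis by (rule path_connected_imp_connected)
qed

text \<open>The distance from \<open>x0\<close> takes every value up to \<open>D\<close>, which
  yields \<open>n\<close> points with gaps \<open>D / n\<close>. Disjoint balls of radius
  \<open>D / (3 * n)\<close> around them carry mass of order n^(1 - d) in total, which is unbounded
  if d < 1.\<close>

lemma connected_regular_dimension_ge_1:
  fixes \<sigma> :: "'a::metric_space measure" and x0 y0 :: 'a
  assumes conn: "connected (UNIV :: 'a set)" and \<sigma>: "finite_measure \<sigma>" "sets \<sigma> = sets borel"
    and C: "C > 0" and D: "D > 0" "dist x0 y0 = D"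
    and lower: "\<And>x r. 0 < r \<Longrightarrow> r \<le> D \<Longrightarrow> C * r powr d \<le> measure \<sigma> (cball (x::'a) r)"
  shows "d \<ge> 1"
proof (rule ccontr)
  assume "\<not> d \<ge> 1"
  then have d: "1 - d > 0" by simp
  define T where "T = measure \<sigma> (space \<sigma>)"
  define b where "b = C * (D / 3) powr d"
  have b: "b > 0" using C D by (simp add: b_def)
  have "real n * b / real n powr d \<le> T" if n: "n > 0" for n :: nat
  proof -
    define s where "s = D / (3 * real n)"
    have s: "s > 0" "s \<le> D" using D n by (auto simp: s_def divide_simps)
    have "connected (range (dist x0))"
      by (rule connected_continuous_image[OF _ conn]) (intro continuous_intros)
    then have ivt: "{0..D} \<subseteq> range (dist x0)"
      using connected_contains_Icc[of "range (dist x0)" 0 D] D(2) by (metis dist_self rangeI)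
    have "\<forall>i. \<exists>z. i < n \<longrightarrow> dist x0 z = real i * (3 * s)"
    proof
      fix i
      have "real i * (3 * s) \<in> {0..D}" if "i < n" using that D n by (auto simp: s_def divide_simps)
      then show "\<exists>z. i < n \<longrightarrow> dist x0 z = real i * (3 * s)" using ivt by fastforce
    qed
    then obtain z where z: "\<And>i. i < n \<Longrightarrow> dist x0 (z i) = real i * (3 * s)" by metis
    have sep: "dist (z i) (z j) > 2 * s" if "i < n" "j < n" "i \<noteq> j" for i j
    proof -
      have "\<bar>dist x0 (z i) - dist x0 (z j)\<bar> \<le> dist (z i) (z j)"
        using abs_dist_diff_le[of "z i" x0 "z j"] by (simp add: dist_commute)
      moreover have "\<bar>dist x0 (z i) - dist x0 (z j)\<bar> = \<bar>real i - real j\<bar> * (3 * s)"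
        using z that s by (simp add: abs_mult flip: left_diff_distrib)
      moreover have "1 * (3 * s) \<le> \<bar>real i - real j\<bar> * (3 * s)" using that s by (intro mult_right_mono) auto
      ultimately show ?thesis using s by linarith
    qed
    then have "inj_on z {..<n}" using s by (intro inj_onI) (force)
    then have "card (z ` {..<n}) = n" by (simp add: card_image)
    moreover have "real (card (z ` {..<n})) * (C * s powr d) \<le> T"
      unfolding T_def using sep by (intro separated_card_bound[OF \<sigma> lower[OF s]]) auto
    moreover have "C * s powr d = b / real n powr d"
      using powr_divide[of "D / 3" "real n" d] by (simp add: s_def b_def)
    ultimately show ?thesis by simp
  qed
  then have le: "real n powr (1 - d) \<le> T / b" if "n > 0" for n :: nat
    using that b by (fastforce simp: powr_diff field_simps)
  have "T / b \<ge> 1" using le[of 1] by simp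
  obtain n :: nat where n: "real n > (T / b) powr (1 / (1 - d))" using reals_Archimedean2 by blast
  have "(T / b) powr (1 / (1 - d)) > 0"
    unfolding powr_gt_zero using \<open>T / b \<ge> 1\<close> by linarith
  then have "n > 0" using n by (cases n) auto
  have "t = (t powr (1 / (1 - d))) powr (1 - d)" if "t \<ge> 1" for t
    using d that by (simp add: powr_powr)
  from this[OF \<open>T / b \<ge> 1\<close>] have "T / b = ((T / b) powr (1 / (1 - d))) powr (1 - d)" .
  also have "\<dots> < real n powr (1 - d)" using n d by (intro powr_less_mono2) auto
  finally show False using le[OF \<open>n > 0\<close>] by simp
qed

section \<open>Choice of the parameters and the resulting rate\<close>

context compact_kernel
begin

text \<open>The condition linking \<open>N\<close> and \<open>L\<close> says that the curve is fast
  enough to complete the walk without rests; all remaining speed is turned into dwelling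
  time.\<close>

lemma lcurve_approximation_rate:
  fixes \<sigma> :: "'a measure"
  assumes len: "length_space TYPE('a)" and \<sigma>: "finite_measure \<sigma>" "sets \<sigma> = sets borel"
    and C: "C > 0" and D: "D > 0" and d: "d \<ge> 1"
    and lower: "\<And>x r. 0 < r \<Longrightarrow> r \<le> D \<Longrightarrow> C * r powr d \<le> measure \<sigma> (cball (x::'a) r)"
  shows "\<exists>E>0. \<forall>\<mu>\<in>prob_measures. \<forall>(N::nat) L. N > 0 \<longrightarrow> E * real N powr (1 - 1 / d) \<le> L \<longrightarrow>
    (\<exists>\<nu>\<in>P_Lcurve L. dsq \<mu> \<nu> \<le> 8 * M / N + 2 * ((E * real N powr (1 - 1 / d) / L)\<^sup>2 * M))"
proof -
  define T where "T = measure \<sigma> (space \<sigma>)"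
  define A where "A = T / (C * D powr d)"
  have A: "A \<ge> 0" using C D by (simp add: A_def T_def)
  \<comment> \<open>The factor is 4 * 2 * 6: 4 from \<open>empirical_approx_along_curve\<close>, 2
    from rounding \<open>k\<close>, and 6 from \<open>\<rho> = 6 * s\<close>.\<close>
  define E where "E = 48 * (A + 1) * D"
  have E: "E > 0" using A D by (simp add: E_def)
  have "\<forall>u v. \<exists>g :: real \<Rightarrow> 'a. (dist u v)-lipschitz_on {0..1} g \<and> g 0 = u \<and> g 1 = v"
    using compact_length_space_geodesic[OF compact_UNIV len] by blast
  then obtain G :: "'a \<Rightarrow> 'a \<Rightarrow> real \<Rightarrow> 'a" where
    G: "\<And>u v. (dist u v)-lipschitz_on {0..1} (G u v)" "\<And>u v. G u v 0 = u" "\<And>u v. G u v 1 = v"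
    by metis
  have conn: "connected (UNIV :: 'a set)" using compact_length_space_connected[OF compact_UNIV len] .
  have "\<exists>\<nu>\<in>P_Lcurve L. dsq \<mu> \<nu> \<le> 8 * M / N + 2 * ((E * real N powr (1 - 1 / d) / L)\<^sup>2 * M)"
    if \<mu>: "\<mu> \<in> prob_measures" and N: "N > 0" and L: "E * real N powr (1 - 1 / d) \<le> L" for \<mu> L and N :: nat
  proof -
    \<comment> \<open>At this radius each ball has mass at least a constant over \<open>N\<close>,
      so a separated set has \<open>O(N)\<close> points.\<close>
    define s where "s = D * real N powr (- (1 / d))"
    have "real N powr (- (1 / d)) \<le> real N powr 0" using N d by (intro powr_mono) auto
    then have s: "s > 0" "s \<le> D" using D N by (auto simp: s_def mult_le_cancel_left1)
    have sN: "s * real N = D * real N powr (1 - 1 / d)"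
      using N by (simp add: s_def powr_diff powr_minus field_simps)
    have sd: "C * s powr d = C * D powr d / N"
    proof -
      have "s powr d = D powr d * (real N powr (- (1 / d))) powr d"
        unfolding s_def using D by (intro powr_mult)
      also have "(real N powr (- (1 / d))) powr d = real N powr (- (1 / d) * d)" by (rule powr_powr)
      also have "- (1 / d) * d = - 1" using d by simp
      also have "real N powr (- 1) = 1 / N" using N by (simp add: powr_minus divide_inverse)
      finally show ?thesis by simp
    qed
    have L0: "L > 0" using L E N by (smt (verit) mult_pos_pos of_nat_0_less_iff powr_gt_zero)
    \<comment> \<open>Separation \<open>3 * s\<close> leaves the strict margin over
      \<open>2 * s\<close> that the packing bound demands.\<close>
    have "real (card Y) \<le> A * N"
      if Y: "finite Y" "\<forall>x\<in>Y. \<forall>y\<in>Y. x \<noteq> y \<longrightarrow> dist x y \<ge> 3 * s" for Y :: "'a set"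
    proof -
      have "\<forall>x\<in>Y. \<forall>y\<in>Y. x \<noteq> y \<longrightarrow> dist x y > 2 * s" using Y(2) s(1) by force
      then have "real (card Y) * (C * D powr d / N) \<le> T"
        unfolding T_def sd[symmetric] by (intro separated_card_bound[OF \<sigma> lower[OF s] Y(1)])
      then show ?thesis using C D N by (simp add: A_def field_simps)
    qed
    then obtain Y :: "'a set" where Y: "finite Y" "\<forall>x. \<exists>y\<in>Y. dist y x < 3 * s" "real (card Y) \<le> A * N"
      using maximal_separated_net[of "3 * s" "A * N"] s(1) by auto
    have Y0: "Y \<noteq> {}" using Y(2) by blast
    then have card: "card Y \<ge> 1" using Y(1) by (simp add: Suc_leI card_gt_0_iff)
    define \<rho> where "\<rho> = 2 * (3 * s)"
    have \<rho>: "\<rho> > 0" using s by (simp add: \<rho>_def)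
    define m0 where "m0 = 2 * card Y + 2 * N - 2"
    have m0: "real m0 = 2 * real (card Y) + 2 * real N - 2" using card by (simp add: m0_def of_nat_diff)
    have "\<rho> * m0 \<le> L"
    proof -
      have "real m0 \<le> 2 * (A + 1) * N" using m0 Y(3) by (simp add: algebra_simps)
      then have "\<rho> * m0 \<le> \<rho> * (2 * (A + 1) * N)" using \<rho> by (intro mult_left_mono) auto
      also have "\<dots> = 12 * (A + 1) * (s * N)" by (simp add: \<rho>_def)
      also have "\<dots> \<le> E * real N powr (1 - 1 / d)"
      proof -
        have "12 * (A + 1) * D \<le> E" unfolding E_def using A D by (intro mult_right_mono) auto
        then have "12 * (A + 1) * D * real N powr (1 - 1 / d) \<le> E * real N powr (1 - 1 / d)"
          by (intro mult_right_mono) auto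
        then show ?thesis by (simp only: sN mult.assoc)
      qed
      finally show ?thesis using L by simp
    qed
    then have quot: "(L / \<rho> - m0) / N \<ge> 0" using \<rho> N by (simp add: field_simps)
    \<comment> \<open>The largest number of rests per point for which the speed
      \<open>\<rho> * m\<close> stays below \<open>L\<close>.\<close>
    define k where "k = nat \<lfloor>(L / \<rho> - m0) / N\<rfloor>"
    have k: "real k \<le> (L / \<rho> - m0) / N" "(L / \<rho> - m0) / N < real k + 1"
      using quot by (simp_all add: k_def)
    define m where "m = m0 + N * k"
    have m: "m + 2 = 2 * card Y + N * (k + 2)" using card by (simp add: m_def m0_def)
    have mL: "\<rho> * m \<le> L"
    proof -
      have "real k * N \<le> L / \<rho> - m0" using k(1) N by (simp add: field_simps)
      then have "real m \<le> L / \<rho>" by (simp add: m_def algebra_simps)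
      then show ?thesis using \<rho> by (simp add: field_simps)
    qed
    \<comment> \<open>Rounding \<open>k\<close> down loses fewer than \<open>N\<close> moves, and
      \<open>N \<le> m\<close>, so at least half of the permitted speed is used.\<close>
    have mlow: "L < 2 * \<rho> * m"
    proof -
      have "L / \<rho> - m0 < (real k + 1) * N" using k(2) N by (simp add: pos_divide_less_eq)
      then have "L / \<rho> < real m + N" by (simp add: m_def algebra_simps)
      moreover have "N \<le> m0" unfolding m0_def using card by linarith
      then have "real N \<le> m" by (simp add: m_def trans_le_add1 del: of_nat_add)
      ultimately have "L / \<rho> < 2 * real m" by simp
      then show ?thesis using \<rho> by (simp add: field_simps)
    qed
    have mpos: "real m > 0" using mlow L0 by (cases "m = 0") auto
    obtain x where x: "dsq \<mu> (empirical_measure N x) \<le> 4 * M / N"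
      using empirical_approximation[OF \<mu> N] by blast
    have near: "\<forall>i. \<exists>y\<in>Y. dist y (x i) \<le> \<rho>"
    proof
      fix i
      obtain y where "y \<in> Y" "dist y (x i) < 3 * s" using Y(2) by blast
      then show "\<exists>y\<in>Y. dist y (x i) \<le> \<rho>" using s(1) by (intro bexI[of _ y]) (auto simp: \<rho>_def)
    qed
    have prox: "\<forall>V. V \<noteq> {} \<longrightarrow> V \<subset> Y \<longrightarrow> (\<exists>v\<in>V. \<exists>y\<in>Y - V. dist v y \<le> \<rho>)"
      unfolding \<rho>_def using net_proximity_connected[OF conn Y(1,2)] by blast
    obtain \<gamma> where \<gamma>: "\<gamma> \<in> closed_lip_curves (\<rho> * m)"
      "\<And>f B. continuous_on UNIV f \<Longrightarrow> (\<forall>x. \<bar>f x\<bar> \<le> B) \<Longrightarrow>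
        \<bar>(\<Sum>i<N. f (x i)) / N - (\<integral>x. f x \<partial>curve_measure \<gamma> (\<lambda>_. 1))\<bar> \<le> (4 * (card Y + N) / m) * B"
      using empirical_approx_along_curve[OF G Y(1) Y0 less_imp_le[OF \<rho>] N prox near m] by blast
    define \<nu> where "\<nu> = curve_measure \<gamma> (\<lambda>_. 1)"
    define \<theta> where "\<theta> = E * real N powr (1 - 1 / d) / L"
    have "\<gamma> \<in> closed_lip_curves L"
      using \<gamma>(1) mL unfolding closed_lip_curves_def by (auto intro: lipschitz_on_mono)
    then have \<nu>L: "\<nu> \<in> P_Lcurve L" unfolding P_Lcurve_eq \<nu>_def by blast
    then have \<nu>: "\<nu> \<in> prob_measures"
      using P_Lcurve_subset_P_Acurve[of L] P_Acurve_subset_prob[of L] L0 by auto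
    have \<theta>: "4 * (card Y + N) / m \<le> \<theta>"
    proof -
      have "real (4 * (card Y + N)) \<le> 4 * (A + 1) * N" using Y(3) by (simp add: algebra_simps)
      then have "real (4 * (card Y + N)) * L \<le> 4 * (A + 1) * N * (2 * \<rho> * m)"
        using mlow A L0 by (intro mult_mono) auto
      also have "\<dots> = E * real N powr (1 - 1 / d) * m"
        using sN by (simp add: E_def \<rho>_def mult_ac)
      finally show ?thesis using mpos L0 by (simp add: \<theta>_def field_simps)
    qed
    have "dsq (empirical_measure N x) \<nu> \<le> \<theta>\<^sup>2 * M"
    proof (rule dsq_le_of_weak_bound[OF empirical_measure_prob \<nu>])
      fix f :: "'a \<Rightarrow> real" and B assume f: "continuous_on UNIV f" "\<And>x. \<bar>f x\<bar> \<le> B"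
      have "B \<ge> 0" using f(2)[of undefined] by linarith
      have "\<bar>(\<integral>y. f y \<partial>empirical_measure N x) - (\<integral>y. f y \<partial>\<nu>)\<bar> \<le> (4 * (card Y + N) / m) * B"
        unfolding integral_empirical_measure[OF N f(1)] \<nu>_def using \<gamma>(2) f by blast
      also have "\<dots> \<le> \<theta> * B" using \<theta> \<open>B \<ge> 0\<close> by (rule mult_right_mono)
      finally show "\<bar>(\<integral>y. f y \<partial>empirical_measure N x) - (\<integral>y. f y \<partial>\<nu>)\<bar> \<le> \<theta> * B" .
    qed
    then have "dsq \<mu> \<nu> \<le> 8 * M / N + 2 * (\<theta>\<^sup>2 * M)"
      using dsq_triangle[OF \<mu> empirical_measure_prob \<nu>, of N x] x by simp
    then show ?thesis using \<nu>L unfolding \<theta>_def by blast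
  qed
  then show ?thesis using E by blast
qed

text \<open>Taking \<open>N\<close> as the integer part of \<open>L powr (2 * \<alpha>)\<close>
  makes both errors of order \<open>\<epsilon>\<^sup>2\<close>. The condition of the rate then
  follows from \<open>E * \<epsilon> \<le> 1\<close>; otherwise \<open>4 * M\<close> is already
  below the claim.\<close>

lemma lcurve_dsq_bound:
  assumes d: "d \<ge> 1" and E: "E > 0"
    and rate: "\<forall>\<mu>\<in>prob_measures. \<forall>(N::nat) L. N > 0 \<longrightarrow> E * real N powr (1 - 1 / d) \<le> L \<longrightarrow>
      (\<exists>\<nu>\<in>P_Lcurve L. dsq \<mu> \<nu> \<le> 8 * M / N + 2 * ((E * real N powr (1 - 1 / d) / L)\<^sup>2 * M))"
    and \<mu>: "\<mu> \<in> prob_measures" and L: "L \<ge> 1"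
  shows "\<exists>\<nu>\<in>P_Lcurve L. dsq \<mu> \<nu> \<le> (16 * M + 4 * M * E\<^sup>2) * (L powr - (d / (3 * d - 2)))\<^sup>2"
proof -
  define \<alpha> where "\<alpha> = d / (3 * d - 2)"
  define \<epsilon> where "\<epsilon> = L powr - \<alpha>"
  have \<epsilon>: "\<epsilon> > 0" using L by (simp add: \<epsilon>_def)
  have \<alpha>: "\<alpha> > 0" using d by (simp add: \<alpha>_def)
  have M0: "M > 0" using M_ge_1 by simp
  show ?thesis
  proof (cases "E * \<epsilon> \<le> 1")
    case True
    have "\<epsilon>\<^sup>2 = L powr (- (2 * \<alpha>))" by (simp add: \<epsilon>_def power2_eq_square flip: powr_add)
    then have inv: "L powr (2 * \<alpha>) = 1 / \<epsilon>\<^sup>2" by (simp add: powr_minus divide_inverse)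
    have ge1: "L powr (2 * \<alpha>) \<ge> 1" using L \<alpha> by (simp add: ge_one_powr_ge_zero)
    define N where "N = nat \<lfloor>L powr (2 * \<alpha>)\<rfloor>"
    have N: "real N \<le> L powr (2 * \<alpha>)" "L powr (2 * \<alpha>) < real N + 1" "N \<ge> 1"
      using ge1 by (auto simp: N_def le_nat_floor)
    have "real N powr (1 - 1 / d) \<le> (L powr (2 * \<alpha>)) powr (1 - 1 / d)"
      using N d by (intro powr_mono2) auto
    also have "\<dots> = L powr (1 - \<alpha>)"
    proof -
      \<comment> \<open>The balance of the two errors, which determines \<alpha>.\<close>
      have "2 * \<alpha> * (1 - 1 / d) = 1 - \<alpha>" using d by (simp add: \<alpha>_def field_simps)
      then show ?thesis by (simp add: powr_powr)
    qed
    also have "\<dots> = L * \<epsilon>" using L by (simp add: \<epsilon>_def powr_diff powr_minus divide_inverse)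
    finally have NL: "E * real N powr (1 - 1 / d) \<le> E * \<epsilon> * L" using E by (simp add: mult_ac)
    also have "\<dots> \<le> L" using True L by (simp add: mult_le_cancel_right1)
    finally have "E * real N powr (1 - 1 / d) \<le> L" .
    then obtain \<nu> where \<nu>: "\<nu> \<in> P_Lcurve L"
      "dsq \<mu> \<nu> \<le> 8 * M / N + 2 * ((E * real N powr (1 - 1 / d) / L)\<^sup>2 * M)"
      using rate \<mu> N(3) by (metis One_nat_def Suc_le_lessD)
    \<comment> \<open>Taking the integer part of a number that is at least 1 loses at most a factor
      2.\<close>
    have "1 / \<epsilon>\<^sup>2 \<le> 2 * real N" using N inv by linarith
    then have first: "8 * M / N \<le> 16 * M * \<epsilon>\<^sup>2" using N(3) \<epsilon> M0 by (simp add: field_simps)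
    have "(E * real N powr (1 - 1 / d) / L)\<^sup>2 \<le> (E * \<epsilon>)\<^sup>2"
      using NL L E by (intro power_mono) (auto simp: pos_divide_le_eq)
    then have "(E * real N powr (1 - 1 / d) / L)\<^sup>2 * M \<le> (E * \<epsilon>)\<^sup>2 * M"
      using M0 by (intro mult_right_mono) auto
    moreover have "(E * \<epsilon>)\<^sup>2 * M = E\<^sup>2 * \<epsilon>\<^sup>2 * M" by (simp only: power_mult_distrib)
    moreover have "E\<^sup>2 * \<epsilon>\<^sup>2 * M \<ge> 0" using M0 by simp
    ultimately have "2 * ((E * real N powr (1 - 1 / d) / L)\<^sup>2 * M) \<le> 4 * (E\<^sup>2 * \<epsilon>\<^sup>2 * M)"
      by linarith
    with first have "dsq \<mu> \<nu> \<le> (16 * M + 4 * M * E\<^sup>2) * \<epsilon>\<^sup>2"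
      using \<nu>(2) by (simp add: algebra_simps)
    then show ?thesis using \<nu>(1) unfolding \<epsilon>_def \<alpha>_def by blast
  next
    case False
    obtain \<nu> :: "'a measure" where \<nu>: "\<nu> \<in> P_Lcurve L" using P_Lcurve_nonempty[of L] L by auto
    then have "\<nu> \<in> prob_measures"
      using P_Lcurve_subset_P_Acurve[of L] P_Acurve_subset_prob[of L] L by auto
    then have "dsq \<mu> \<nu> \<le> 4 * M" using dsq_bound[OF \<mu>] by fastforce
    also have "1 \<le> (E * \<epsilon>)\<^sup>2" using False by (intro one_le_power) auto
    then have "4 * M * 1 \<le> 4 * M * (E * \<epsilon>)\<^sup>2" using M0 by (intro mult_left_mono) auto
    then have "4 * M \<le> (16 * M + 4 * M * E\<^sup>2) * \<epsilon>\<^sup>2"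
      using M0 by (simp add: algebra_simps power_mult_distrib add_increasing)
    finally show ?thesis using \<nu> unfolding \<epsilon>_def \<alpha>_def by blast
  qed
qed

lemma minimizers_with_rate:
  assumes \<mu>: "\<mu> \<in> prob_measures" and L: "L \<ge> 1" and c: "c \<ge> 0"
    and \<nu>0: "\<nu>0 \<in> P_Lcurve L" "dsq \<mu> \<nu>0 \<le> c\<^sup>2 * e\<^sup>2" and e: "e \<ge> 0"
  shows "\<exists>\<nu>A\<in>P_Acurve L. (\<forall>\<nu>\<in>P_Acurve L. discrepancy K \<mu> \<nu>A \<le> discrepancy K \<mu> \<nu>) \<and>
    (\<exists>\<nu>L\<in>P_Lcurve L. (\<forall>\<nu>\<in>P_Lcurve L. discrepancy K \<mu> \<nu>L \<le> discrepancy K \<mu> \<nu>) \<and>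
      discrepancy K \<mu> \<nu>A \<le> discrepancy K \<mu> \<nu>L \<and> discrepancy K \<mu> \<nu>L \<le> c * e)"
proof -
  obtain \<nu>A where A: "\<nu>A \<in> P_Acurve L" "\<And>\<nu>. \<nu> \<in> P_Acurve L \<Longrightarrow> dsq \<mu> \<nu>A \<le> dsq \<mu> \<nu>"
    using P_Acurve_attains_min[OF \<mu>, of L] L by auto
  obtain \<nu>L where B: "\<nu>L \<in> P_Lcurve L" "\<And>\<nu>. \<nu> \<in> P_Lcurve L \<Longrightarrow> dsq \<mu> \<nu>L \<le> dsq \<mu> \<nu>"
    using P_Lcurve_attains_min[OF \<mu>, of L] L by auto
  have "\<nu>L \<in> P_Acurve L" using B(1) P_Lcurve_subset_P_Acurve[of L] L by auto
  then have "dsq \<mu> \<nu>A \<le> dsq \<mu> \<nu>L" by (rule A(2))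
  moreover have "dsq \<mu> \<nu>L \<le> (c * e)\<^sup>2" using B(2)[OF \<nu>0(1)] \<nu>0(2) by (simp add: power_mult_distrib)
  then have "sqrt (dsq \<mu> \<nu>L) \<le> c * e" using c e by (intro real_le_lsqrt) auto
  ultimately show ?thesis
    unfolding discrepancy_eq using A B by (metis real_sqrt_le_mono)
qed

end

theorem theorem2:
  fixes \<sigma> :: "'a::metric_space measure" and d :: real and K :: "'a \<Rightarrow> 'a \<Rightarrow> real"
  assumes "compact (UNIV :: 'a set)"
    and "d > 0"
    and "ahlfors_regular \<sigma> d"
    and "length_space TYPE('a)"
    and "continuous_on UNIV (\<lambda>(x, y). K x y)"
    and "pd_kernel K"
  shows "\<exists>c>0. \<forall>\<mu> L. \<mu> \<in> prob_measures \<and> L \<ge> 1 \<longrightarrow>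
           (\<exists>\<nu>A\<in>P_Acurve L. (\<forall>\<nu>\<in>P_Acurve L. discrepancy K \<mu> \<nu>A \<le> discrepancy K \<mu> \<nu>) \<and>
           (\<exists>\<nu>L\<in>P_Lcurve L. (\<forall>\<nu>\<in>P_Lcurve L. discrepancy K \<mu> \<nu>L \<le> discrepancy K \<mu> \<nu>) \<and>
              discrepancy K \<mu> \<nu>A \<le> discrepancy K \<mu> \<nu>L \<and>
              discrepancy K \<mu> \<nu>L \<le> c * L powr (- (d / (3 * d - 2)))))"
proof -
  interpret compact_kernel K using assms by unfold_locales
  have "\<exists>c>0. \<forall>\<mu> L. \<mu> \<in> prob_measures \<and> L \<ge> 1 \<longrightarrow>
    (\<exists>\<nu>\<in>P_Lcurve L. dsq \<mu> \<nu> \<le> c\<^sup>2 * (L powr (- (d / (3 * d - 2))))\<^sup>2)"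
  proof (cases "\<exists>x y :: 'a. x \<noteq> y")
    case True
    obtain C1 where C1: "C1 > 0"
      "\<And>x r. 0 < r \<Longrightarrow> r \<le> diameter (UNIV :: 'a set) \<Longrightarrow> C1 * r powr d \<le> measure \<sigma> (cball x r)"
      using assms(3) unfolding ahlfors_regular_def by blast
    have \<sigma>: "finite_measure \<sigma>" "sets \<sigma> = sets borel"
      using assms(3) unfolding ahlfors_regular_def by blast+
    obtain x y :: 'a where "x \<noteq> y" using True by blast
    \<comment> \<open>Any positive distance serves as the largest scale; it is at most the diameter,
      so the lower mass bound holds up to \<open>D\<close>.\<close>
    define D where "D = dist x y"
    have D: "D > 0" using \<open>x \<noteq> y\<close> by (simp add: D_def)
    have "D \<le> diameter (UNIV :: 'a set)"
      unfolding D_def using compact_imp_bounded[OF assms(1)] by (intro diameter_bounded_bound) auto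
    then have lower: "\<And>x r. 0 < r \<Longrightarrow> r \<le> D \<Longrightarrow> C1 * r powr d \<le> measure \<sigma> (cball x r)"
      using C1(2) by simp
    have d: "d \<ge> 1"
      using connected_regular_dimension_ge_1[OF compact_length_space_connected[OF assms(1,4)] \<sigma> C1(1) D D_def[symmetric] lower] .
    obtain E where E: "E > 0" "\<forall>\<mu>\<in>prob_measures. \<forall>(N::nat) L. N > 0 \<longrightarrow> E * real N powr (1 - 1 / d) \<le> L \<longrightarrow>
      (\<exists>\<nu>\<in>P_Lcurve L. dsq \<mu> \<nu> \<le> 8 * M / N + 2 * ((E * real N powr (1 - 1 / d) / L)\<^sup>2 * M))"
      using lcurve_approximation_rate[OF assms(4) \<sigma> C1(1) D d lower] by blast
    have pos: "16 * M + 4 * M * E\<^sup>2 > 0" using M_ge_1 by (simp add: add_pos_nonneg)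
    show ?thesis
      using lcurve_dsq_bound[OF d E] pos
      by (intro exI[of _ "sqrt (16 * M + 4 * M * E\<^sup>2)"]) (simp add: real_sqrt_pow2 less_imp_le)
  next
    \<comment> \<open>With one point the diameter is 0 and \<open>d \<ge> 1\<close> may fail, so the
      exponent can have either sign. The kernel is constant here, every discrepancy vanishes, and
      the constant 1 works.\<close>
    case False
    have zero: "dsq \<mu> \<nu> = 0" if "\<mu> \<in> prob_measures" "\<nu> \<in> prob_measures" for \<mu> \<nu>
    proof -
      define \<kappa> where "\<kappa> = K undefined undefined"
      have K: "K x y = \<kappa>" for x y unfolding \<kappa>_def using False by metis
      have one: "measure \<mu>' UNIV = 1" if "\<mu>' \<in> prob_measures" for \<mu>' :: "'a measure"
        using prob_space.prob_space[of \<mu>'] prob_measures_D[OF that] by simp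
      have "kernel_energy K \<mu>' \<nu>' = \<kappa>"
        if "\<mu>' \<in> prob_measures" "\<nu>' \<in> prob_measures" for \<mu>' \<nu>'
        unfolding kernel_energy_def K using that by (simp add: prob_measures_D one)
      then show ?thesis using that by (simp add: dsq_def)
    qed
    have "\<exists>\<nu>\<in>P_Lcurve L. dsq \<mu> \<nu> \<le> 1\<^sup>2 * (L powr (- (d / (3 * d - 2))))\<^sup>2"
      if \<mu>: "\<mu> \<in> prob_measures" and L: "L \<ge> 1" for \<mu> L
    proof -
      obtain \<nu> :: "'a measure" where "\<nu> \<in> P_Lcurve L" "\<nu> \<in> prob_measures"
        using P_Lcurve_nonempty[of L] P_Lcurve_subset_P_Acurve[of L] P_Acurve_subset_prob[of L] L by fastforce
      then show ?thesis using zero[OF \<mu>] by (intro bexI[of _ \<nu>]) simp_all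
    qed
    then show ?thesis by (meson zero_less_one)
  qed
  then obtain c where c: "c > 0" "\<And>\<mu> L. \<mu> \<in> prob_measures \<Longrightarrow> L \<ge> 1 \<Longrightarrow>
    \<exists>\<nu>\<in>P_Lcurve L. dsq \<mu> \<nu> \<le> c\<^sup>2 * (L powr (- (d / (3 * d - 2))))\<^sup>2" by blast
  show ?thesis
  proof (intro exI[of _ c] conjI allI impI; (elim conjE)?)
    fix \<mu> :: "'a measure" and L :: real assume \<mu>: "\<mu> \<in> prob_measures" and L: "L \<ge> 1"
    obtain \<nu>0 where "\<nu>0 \<in> P_Lcurve L" "dsq \<mu> \<nu>0 \<le> c\<^sup>2 * (L powr (- (d / (3 * d - 2))))\<^sup>2"
      using c(2)[OF \<mu> L] by blast
    from minimizers_with_rate[OF \<mu> L less_imp_le[OF c(1)] this powr_ge_zero]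
    show "\<exists>\<nu>A\<in>P_Acurve L. (\<forall>\<nu>\<in>P_Acurve L. discrepancy K \<mu> \<nu>A \<le> discrepancy K \<mu> \<nu>) \<and>
           (\<exists>\<nu>L\<in>P_Lcurve L. (\<forall>\<nu>\<in>P_Lcurve L. discrepancy K \<mu> \<nu>L \<le> discrepancy K \<mu> \<nu>) \<and>
              discrepancy K \<mu> \<nu>A \<le> discrepancy K \<mu> \<nu>L \<and>
              discrepancy K \<mu> \<nu>L \<le> c * L powr (- (d / (3 * d - 2))))" .
  qed (rule c(1))
qed

end
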